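(* Let $k, n, r, s$ be non-negative integers with $n \geq r(k-1)+1$, $k > s \geq 0$ and $r \geq 2$. Then $$\chi\big(KG^{r}(n,k,s)\big) \geq \left\lceil \frac{n - r(k-s-1)}{r-1} \right\rceil.$$
   Context: For a positive integer $n$, $[n]=\{1,\ldots,n\}$. A hypergraph $\mathcal{H}=(V,E)$ consists of a finite vertex set $V$ and a set $E$ of non-empty subsets of $V$ (edges). A proper $m$-coloring of $\mathcal{H}$ is a map $c:V\to\{1,\ldots,m\}$ such that no edge is monochromatic, i.e. $|c(e)|\geq 2$ for every edge $e$. The chromatic number $\chi(\mathcal{H})$ is the least $m$ for which a proper $m$-coloring exists. The generalized Kneser hypergraph $KG^{r}(n,k,s)$ has as vertices all $k$-element subsets of $[n]$, and its edges are the sets $\{X_1,\ldots,X_r\}$ of $r$ distinct vertices such that $|X_i\cap X_j|\leq s$ for all $i\neq j$. *)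

theory Defs
  imports Complex_Main
begin

definition proper_coloring :: "'a set \<Rightarrow> 'a set set \<Rightarrow> nat \<Rightarrow> ('a \<Rightarrow> nat) \<Rightarrow> bool" where
  "proper_coloring V E m c \<longleftrightarrow>
     (\<forall>v\<in>V. c v \<in> {1..m}) \<and> (\<forall>e\<in>E. card (c ` e) \<ge> 2)"

definition chromatic_number :: "'a set \<Rightarrow> 'a set set \<Rightarrow> nat" where
  "chromatic_number V E = (LEAST m. \<exists>c. proper_coloring V E m c)"

definition KG_vertices :: "nat \<Rightarrow> nat \<Rightarrow> nat set set" where
  "KG_vertices n k = {X. X \<subseteq> {1..n} \<and> card X = k}"

definition KG_edges :: "nat \<Rightarrow> nat \<Rightarrow> nat \<Rightarrow> nat \<Rightarrow> nat set set set" where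
  "KG_edges r n k s = {e. e \<subseteq> KG_vertices n k \<and> finite e \<and> card e = r \<and>
      (\<forall>X\<in>e. \<forall>Y\<in>e. X \<noteq> Y \<longrightarrow> card (X \<inter> Y) \<le> s)}"

end

theory Submission
  imports Defs "HOL-Number_Theory.Cong"
begin

text \<open>
  Suppose that \<open>t\<close> colours suffice and \<open>n > r (k - s - 1) + (r - 1) t\<close>.

  For \<open>r = p\<close> prime, consider the vectors \<open>X\<close> in \<open>(\<int>\<^sub>p \<union> {0})\<^sup>n - {0}\<close>, ordered by extension,
  and let \<open>X\<^sup>a\<close> be the set of coordinates with sign \<open>a\<close>. If some \<open>k\<close>-set \<open>A\<close> consists of at least
  \<open>k - s\<close> elements of a single \<open>X\<^sup>a\<close> and of zeros of \<open>X\<close>, label \<open>X\<close> by \<open>a\<close> and the colour of \<open>A\<close>.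
  Otherwise \<open>X\<close> has at most \<open>p (k - s - 1)\<close> nonzero entries (this uses \<open>n \<ge> p (k - 1) + 1\<close>);
  label it by their number and by its first sign. If \<open>X \<subseteq> Y\<close> get different signs, then the set \<open>B\<close>
  chosen for \<open>Y\<close> avoids the at least \<open>k - s\<close> elements of \<open>A\<close> that lie in the support of \<open>X\<close>, so
  \<open>|A \<inter> B| \<le> s\<close>. Hence \<open>p\<close> different signs with one colour along a chain would give a monochromatic
  edge, and a chain carries at most \<open>p (k - s - 1) + (p - 1) t < n\<close> labels, contradicting the
  \<open>\<int>\<^sub>p\<close>-Tucker lemma. The latter is proved with cochains on lists modulo \<open>p\<close>, as in Dold's theorem.

  For \<open>r = a b\<close>, colour each \<open>m\<close>-set by the colour of a monochromatic edge with \<open>a\<close> vertices inside it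
  and look for a monochromatic edge with \<open>b\<close> vertices among the \<open>m\<close>-sets. Taking these disjoint may
  require an \<open>m\<close> below \<open>a (k - 1) + 1\<close>; then one enlarges \<open>m\<close> to this value and lets the \<open>m\<close>-sets
  overlap in at most \<open>a s - (a - 1) t\<close> elements, which is at most \<open>s\<close> once \<open>s\<close> is chosen minimal.
\<close>

section \<open>Alternating cochains\<close>

text \<open>The simplicial coboundary on vertex lists, an alternating sum over deletions of one
  entry. Lists of length \<open>j\<close> stand for simplices of dimension \<open>j - 1\<close>; the
  empty list supplies the augmentation.\<close>

fun cobd :: "('a list \<Rightarrow> int) \<Rightarrow> 'a list \<Rightarrow> int" where
  "cobd f [] = 0"
| "cobd f (x # xs) = f xs - cobd (\<lambda>ys. f (x # ys)) xs"

lemma cobd_diff: "cobd (\<lambda>ys. f ys - h ys) xs = cobd f xs - cobd h xs"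
  by (induction xs arbitrary: f h) auto

lemma cobd_zero: "cobd (\<lambda>ys. 0) xs = 0"
  using cobd_diff[of "\<lambda>_. 0" "\<lambda>_. 0" xs] by simp

lemma cobd_uminus: "cobd (\<lambda>ys. - f ys) xs = - cobd f xs"
  using cobd_diff[of "\<lambda>_. 0" f xs] by (simp add: cobd_zero)

lemma cobd_sum: "cobd (\<lambda>ys. \<Sum>i\<in>I. f i ys) xs = (\<Sum>i\<in>I. cobd (f i) xs)"
  by (induction xs arbitrary: f) (auto simp: sum_subtractf)

lemma cobd_map: "cobd (\<lambda>ys. f (map h ys)) xs = cobd f (map h xs)"
  by (induction xs arbitrary: f) auto

lemma cobd_cobd: "cobd (cobd f) xs = 0"
  by (induction xs arbitrary: f) (auto simp: cobd_diff)

lemma cobd_cong: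
  assumes "\<And>ys. set ys \<subseteq> set xs \<Longrightarrow> Suc (length ys) = length xs \<Longrightarrow> [f ys = h ys] (mod m)"
  shows "[cobd f xs = cobd h xs] (mod m)"
  using assms
proof (induction xs arbitrary: f h)
  case (Cons x xs)
  have "[cobd (\<lambda>ys. f (x # ys)) xs = cobd (\<lambda>ys. h (x # ys)) xs] (mod m)"
    by (rule Cons.IH, rule Cons.prems) auto
  moreover have "[f xs = h xs] (mod m)"
    by (rule Cons.prems) auto
  ultimately show ?case
    by (simp add: cong_diff)
qed simp

definition alternating :: "('a list \<Rightarrow> int) \<Rightarrow> bool" where
  "alternating f \<longleftrightarrow> (\<forall>us x y vs. f (us @ x # y # vs) = - f (us @ y # x # vs))"

lemma alternatingD: "alternating f \<Longrightarrow> f (us @ x # y # vs) = - f (us @ y # x # vs)"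
  unfolding alternating_def by blast

lemma alternating_Cons: "alternating f \<Longrightarrow> alternating (\<lambda>ys. f (x # ys))"
  unfolding alternating_def by (metis append_Cons)

text \<open>Swapping adjacent entries exchanges the two terms in which one of them is deleted, and
  these carry opposite signs. All other terms change sign because \<open>f\<close>
  alternates.\<close>

lemma alternating_cobd:
  assumes "alternating f"
  shows "alternating (cobd f)"
proof -
  have "cobd f (us @ x # y # vs) = - cobd f (us @ y # x # vs)" for us x y vs
    using assms
  proof (induction us arbitrary: f)
    case Nil
    have "(\<lambda>zs. f (x # y # zs)) = (\<lambda>zs. - f (y # x # zs))"
      using alternatingD[OF Nil, of "[]" x y] by auto
    then have "cobd (\<lambda>zs. f (x # y # zs)) vs = - cobd (\<lambda>zs. f (y # x # zs)) vs"
      by (simp add: cobd_uminus)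
    then show ?case by simp
  next
    case (Cons u us)
    show ?case
      using alternatingD[OF Cons.prems, of us x y vs] Cons.IH[OF alternating_Cons[OF Cons.prems, of u]]
      by simp
  qed
  then show ?thesis unfolding alternating_def by blast
qed

text \<open>Adjacent swaps bring two equal entries together; swapping these shows that the value is
  its own negative.\<close>

lemma alternating_not_distinct:
  assumes "alternating f" "\<not> distinct xs"
  shows "f xs = 0"
proof -
  have "f (us @ y # bs @ y # vs) = 0" for us y bs vs
  proof (induction bs arbitrary: us)
    case Nil
    show ?case using alternatingD[OF assms(1), of us y y vs] by simp
  next
    case (Cons b bs)
    show ?case
      using alternatingD[OF assms(1), of us y b "bs @ y # vs"] Cons.IH[of "us @ [b]"] by simp
  qed
  then show ?thesis
    using not_distinct_decomp[OF assms(2)] by auto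
qed

text \<open>The coefficients \<open>g - 1\<close> and \<open>1 + g + \<dots> + g\<^sup>p\<^sup>-\<^sup>1\<close> of the periodic resolution of \<open>\<int>\<close> over
  \<open>\<int>[\<int>\<^sub>p]\<close>; their products vanish.\<close>

definition tau :: "nat \<Rightarrow> ('a \<Rightarrow> 'a) \<Rightarrow> nat \<Rightarrow> ('a list \<Rightarrow> int) \<Rightarrow> 'a list \<Rightarrow> int" where
  "tau p g j f xs = (if j = 0 then f xs
     else if odd j then f (map g xs) - f xs
     else (\<Sum>i<p. f (map (g ^^ i) xs)))"

lemma tau_cobd: "tau p g j (cobd f) xs = cobd (tau p g j f) xs"
proof -
  have *: "tau p g j f = (if j = 0 then f else if odd j then (\<lambda>xs. f (map g xs) - f xs)
     else (\<lambda>xs. \<Sum>i<p. f (map (g ^^ i) xs)))"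
    by (auto simp: tau_def)
  show ?thesis
    unfolding * by (auto simp: tau_def cobd_diff cobd_sum cobd_map)
qed

lemma tau_diff: "tau p g j (\<lambda>ys. f ys - h ys) xs = tau p g j f xs - tau p g j h xs"
  by (auto simp: tau_def sum_subtractf)

text \<open>Both products are \<open>g ^^ p\<close> minus the identity, as a telescoping sum. For
  \<open>j = 0\<close> the outer factor is the identity, and the inner one vanishes on the empty
  list because \<open>g\<close> fixes it.\<close>

lemma tau_tau:
  assumes "\<And>x. x \<in> set xs \<Longrightarrow> (g ^^ p) x = x" and "j = 0 \<Longrightarrow> xs = []"
  shows "tau p g j (tau p g (Suc j) f) xs = 0"
proof (cases "j = 0")
  case False
  have "(\<Sum>i<p. f (map (g ^^ Suc i) xs) - f (map (g ^^ i) xs)) = f (map (g ^^ p) xs) - f (map (g ^^ 0) xs)"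
    by (rule sum_lessThan_telescope)
  also have "map (g ^^ p) xs = xs"
    using assms(1) by (simp add: map_idI)
  finally have *: "(\<Sum>i<p. f (map (g ^^ Suc i) xs) - f (map (g ^^ i) xs)) = 0"
    by (simp del: funpow.simps(2))
  show ?thesis
  proof (cases "odd j")
    case True
    have "tau p g j (tau p g (Suc j) f) xs =
        (\<Sum>i<p. f (map (g ^^ i) (map g xs))) - (\<Sum>i<p. f (map (g ^^ i) xs))"
      using True False by (simp add: tau_def)
    also have "\<dots> = (\<Sum>i<p. f (map (g ^^ Suc i) xs) - f (map (g ^^ i) xs))"
      by (simp add: sum_subtractf funpow_Suc_right del: funpow.simps)
    finally show ?thesis using * by simp
  next
    case even: False
    then have "tau p g j (tau p g (Suc j) f) xs =
        (\<Sum>i<p. f (map g (map (g ^^ i) xs)) - f (map (g ^^ i) xs))"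
      using False by (simp add: tau_def)
    also have "\<dots> = (\<Sum>i<p. f (map (g ^^ Suc i) xs) - f (map (g ^^ i) xs))"
      by simp
    finally show ?thesis using * by simp
  qed
qed (use assms in \<open>simp add: tau_def\<close>)

section \<open>Free cyclic actions and division of cochains\<close>

text \<open>The equivariant map \<open>deg\<close> from \<open>K\<close> to \<open>\<int>\<^sub>p\<close> witnesses that the action on \<open>K\<close> is free.\<close>

locale free_complex =
  fixes p :: nat and g :: "'a \<Rightarrow> 'a" and K :: "'a set set" and deg :: "'a set \<Rightarrow> nat"
  assumes p_pos: "p > 0"
    and K_subset: "\<And>S T. S \<in> K \<Longrightarrow> T \<subseteq> S \<Longrightarrow> T \<noteq> {} \<Longrightarrow> T \<in> K"
    and K_image: "\<And>S. S \<in> K \<Longrightarrow> g ` S \<in> K"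
    and g_period: "\<And>S x. S \<in> K \<Longrightarrow> x \<in> S \<Longrightarrow> (g ^^ p) x = x"
    and deg_less: "\<And>S. S \<in> K \<Longrightarrow> deg S < p"
    and deg_image: "\<And>S. S \<in> K \<Longrightarrow> deg (g ` S) = Suc (deg S) mod p"
begin

text \<open>\<open>theta j\<close> divides a cochain by \<open>tau j\<close>. As \<open>deg\<close> is a function of the set of the list and not
  of its order, this preserves alternation.\<close>

definition theta :: "nat \<Rightarrow> ('a list \<Rightarrow> int) \<Rightarrow> 'a list \<Rightarrow> int" where
  "theta j f xs = (if j = 0 then f xs
     else if odd j then (\<Sum>i=1..deg (set xs). f (map (g ^^ (p - i)) xs))
     else if deg (set xs) = 0 then f xs else 0)"

text \<open>A zigzag that starts at the augmentation: divide by the resolution, then apply the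
  coboundary. The values of \<open>psi j\<close> matter on lists of length \<open>j\<close>.\<close>

primrec psi :: "nat \<Rightarrow> 'a list \<Rightarrow> int" where
  "psi 0 = (\<lambda>xs. if xs = [] then 1 else 0)"
| "psi (Suc j) = cobd (theta j (psi j))"

lemma alternating_theta:
  assumes "alternating f"
  shows "alternating (theta j f)"
proof -
  have *: "set (us @ x # y # vs) = set (us @ y # x # vs)" for us vs and x y :: 'a
    by auto
  show ?thesis
    unfolding alternating_def
  proof (intro allI)
    fix us vs :: "'a list" and x y :: 'a
    have "f (map h (us @ x # y # vs)) = - f (map h (us @ y # x # vs))" for h
      by (simp add: alternatingD[OF assms, of "map h us" "h x" "h y" "map h vs"])
    then show "theta j f (us @ x # y # vs) = - theta j f (us @ y # x # vs)"
      using alternatingD[OF assms, of us x y vs]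
      by (simp only: theta_def *[of us x y vs] sum_negf minus_zero split: if_split) simp
  qed
qed

lemma alternating_psi: "alternating (psi j)"
proof (induction j)
  case 0
  show ?case by (simp add: alternating_def)
qed (simp add: alternating_cobd alternating_theta)

lemma K_image_funpow: "S \<in> K \<Longrightarrow> (g ^^ i) ` S \<in> K"
proof (induction i)
  case (Suc i)
  then show ?case using K_image[of "(g ^^ i) ` S"] by (simp add: image_comp)
qed simp

lemma deg_image_funpow: "S \<in> K \<Longrightarrow> deg ((g ^^ i) ` S) = (deg S + i) mod p"
proof (induction i)
  case (Suc i)
  then have "deg ((g ^^ Suc i) ` S) = Suc (deg ((g ^^ i) ` S)) mod p"
    using deg_image[OF K_image_funpow[OF Suc.prems, of i]] by (simp add: image_comp)
  then show ?case using Suc by (simp add: mod_Suc_eq)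
qed (simp add: deg_less)

text \<open>Exactness of the resolution on a free orbit: what \<open>tau (Suc j)\<close> kills is
  \<open>tau j\<close> of something. For odd \<open>j\<close> that something is a partial sum along
  the orbit, counted from the member of degree 0; for even \<open>j\<close> it is \<open>f\<close>
  restricted to that member.\<close>

lemma tau_theta:
  assumes xs: "set xs \<in> K" and "j > 0"
    and inv: "\<And>ys. set ys \<in> K \<Longrightarrow> length ys = length xs \<Longrightarrow> [tau p g (Suc j) f ys = 0] (mod int p)"
  shows "[tau p g j (theta j f) xs = f xs] (mod int p)"
proof -
  have per: "map (g ^^ p) xs = xs"
    using g_period[OF xs] by (simp add: map_idI)
  define d where "d = deg (set xs)"
  have d: "d < p" using deg_less[OF xs] by (simp add: d_def)
  show ?thesis
  proof (cases "odd j")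
    case True
    have 1: "tau p g j (theta j f) xs = theta j f (map g xs) - theta j f xs"
      using True by (auto simp: tau_def)
    have 2: "theta j f xs = (\<Sum>i=1..d. f (map (g ^^ (p - i)) xs))"
      using True \<open>j > 0\<close> by (simp add: theta_def d_def)
    have 3: "deg (set (map g xs)) = Suc d mod p"
      using deg_image[OF xs] by (simp add: d_def)
    have N: "[(\<Sum>i<p. f (map (g ^^ i) xs)) = 0] (mod int p)"
      using inv[OF xs] True by (simp add: tau_def)
    show ?thesis
    proof (cases "Suc d < p")
      case lt: True
      have "theta j f (map g xs) = (\<Sum>i=1..Suc d. f (map (g ^^ (p - i)) (map g xs)))"
        using True \<open>j > 0\<close> lt 3 by (simp add: theta_def)
      also have "\<dots> = (\<Sum>i\<in>{0..d}. f (map (g ^^ (p - Suc i)) (map g xs)))"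
        using sum.shift_bounds_cl_Suc_ivl[of "\<lambda>i. f (map (g ^^ (p - i)) (map g xs))" 0 d] by simp
      also have "\<dots> = (\<Sum>i\<in>{0..d}. f (map (g ^^ (p - i)) xs))"
      proof (rule sum.cong)
        fix i assume "i \<in> {0..d}"
        then have "p - i = Suc (p - Suc i)" using d by auto
        then show "f (map (g ^^ (p - Suc i)) (map g xs)) = f (map (g ^^ (p - i)) xs)"
          by (simp add: funpow_Suc_right del: funpow.simps)
      qed simp
      also have "\<dots> = f xs + theta j f xs"
        by (simp add: sum.atLeast_Suc_atMost per 2)
      finally show ?thesis using 1 by simp
    next
      case False
      \<comment> \<open>At the end of the orbit the degree wraps to 0 and the partial sum restarts.
        The resulting error is the sum over the whole orbit, which vanishes modulo \<open>p\<close>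
        by \<open>inv\<close>.\<close>
      then have p: "p = Suc d" using d by simp
      have "theta j f (map g xs) = 0"
        using True \<open>j > 0\<close> 3 by (simp add: theta_def flip: p)
      moreover have "theta j f xs = (\<Sum>i<p. f (map (g ^^ i) xs)) - f xs"
      proof -
        have "theta j f xs = (\<Sum>i=1..<p. f (map (g ^^ (p - i)) xs))"
          using 2 p by (simp add: atLeastLessThanSuc_atLeastAtMost)
        also have "\<dots> = (\<Sum>i=1..<p. f (map (g ^^ i) xs))"
          by (rule sum.reindex_bij_witness[of _ "\<lambda>i. p - i" "\<lambda>i. p - i"]) auto
        also have "\<dots> = (\<Sum>i<p. f (map (g ^^ i) xs)) - f xs"
          using p_pos by (simp add: lessThan_atLeast0 sum.atLeast_Suc_lessThan)
        finally show ?thesis .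
      qed
      ultimately have "tau p g j (theta j f) xs = f xs - (\<Sum>i<p. f (map (g ^^ i) xs))"
        using 1 by simp
      then show ?thesis using cong_diff[OF cong_refl[of "f xs"] N] by simp
    qed
  next
    case False
    have inv1: "[f (map (g ^^ i) xs) = f xs] (mod int p)" for i
    proof (induction i)
      case (Suc i)
      have "[tau p g (Suc j) f (map (g ^^ i) xs) = 0] (mod int p)"
        by (rule inv) (simp_all add: K_image_funpow xs)
      then have "[f (map (g ^^ Suc i) xs) = f (map (g ^^ i) xs)] (mod int p)"
        using False by (simp add: tau_def cong_diff_iff_cong_0 comp_def)
      then show ?case using Suc cong_trans by blast
    qed simp
    \<comment> \<open>The only rotation by less than \<open>p\<close> steps that brings
      \<open>xs\<close> to degree 0.\<close>
    define i0 where "i0 = (p - d) mod p"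
    have i0: "i0 < p" using p_pos by (simp add: i0_def)
    have deg0: "(d + i) mod p = 0 \<longleftrightarrow> i = i0" if "i < p" for i
    proof (cases "d = 0")
      case False
      then have "i0 = p - d" using d p_pos by (simp add: i0_def)
      moreover have "(d + i) mod p = (if d + i < p then d + i else d + i - p)"
        using d that by (simp add: mod_if)
      ultimately show ?thesis using d False by auto
    qed (use that p_pos in \<open>simp add: i0_def\<close>)
    have "tau p g j (theta j f) xs = (\<Sum>i<p. theta j f (map (g ^^ i) xs))"
      using False \<open>j > 0\<close> by (simp add: tau_def)
    also have "\<dots> = (\<Sum>i<p. if i = i0 then f (map (g ^^ i) xs) else 0)"
      using False \<open>j > 0\<close> deg_image_funpow[OF xs] deg0
      by (intro sum.cong) (auto simp: theta_def d_def)
    also have "\<dots> = f (map (g ^^ i0) xs)"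
      using i0 by simp
    finally show ?thesis using inv1[of i0] by simp
  qed
qed

text \<open>Supplies the invariance that \<open>tau_theta\<close> demands of \<open>psi j\<close>.
  On singletons \<open>psi 1\<close> is 1, so its orbit sum is \<open>p\<close>, which is where the
  modulus comes from. Afterwards \<open>tau\<close> has period 2 and commutes with
  \<open>cobd\<close>, and \<open>psi j\<close> is itself a coboundary.\<close>

lemma tau_psi: "j > 0 \<Longrightarrow> set xs \<in> K \<Longrightarrow> length xs = j \<Longrightarrow> [tau p g (Suc j) (psi j) xs = 0] (mod int p)"
proof (induction j arbitrary: xs)
  case (Suc j)
  show ?case
  proof (cases "j = 0")
    case True
    then obtain x where "xs = [x]"
      using Suc.prems by (auto simp: length_Suc_conv)
    then have "tau p g (Suc (Suc j)) (psi (Suc j)) xs = int p"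
      using True by (simp add: tau_def theta_def)
    then show ?thesis by (simp add: cong_def)
  next
    case False
    have "[cobd (tau p g j (theta j (psi j))) xs = cobd (psi j) xs] (mod int p)"
    proof (rule cobd_cong)
      fix ys assume ys: "set ys \<subseteq> set xs" "Suc (length ys) = length xs"
      then have "ys \<noteq> []" using Suc.prems False by auto
      then have "set ys \<in> K" using K_subset[OF Suc.prems(2) ys(1)] by simp
      then show "[tau p g j (theta j (psi j)) ys = psi j ys] (mod int p)"
        using False Suc.IH Suc.prems ys by (intro tau_theta) simp_all
    qed
    moreover have "cobd (psi j) xs = 0"
      using False by (cases j) (auto simp: cobd_cobd)
    moreover have "tau p g (Suc (Suc j)) = (tau p g j :: ('a list \<Rightarrow> int) \<Rightarrow> 'a list \<Rightarrow> int)"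
      using False by (intro ext) (simp add: tau_def)
    ultimately show ?thesis by (simp add: tau_cobd)
  qed
qed simp

lemma tau_theta_psi:
  assumes "length xs = j" "xs \<noteq> [] \<Longrightarrow> set xs \<in> K"
  shows "[tau p g j (theta j (psi j)) xs = psi j xs] (mod int p)"
proof (cases "j = 0")
  case True
  then show ?thesis by (simp add: tau_def theta_def)
next
  case False
  then have "set xs \<in> K" using assms by auto
  then show ?thesis using False tau_psi assms(1) by (intro tau_theta) simp_all
qed

end

section \<open>The Tucker lemma for a cyclic group of prime order\<close>

text \<open>The alternating sum over the simplices \<open>x1, ..., xi, h xi, ..., h xk\<close> that
  triangulate the prism between a simplex and its image under \<open>h\<close>.\<close>

fun prism :: "('a \<Rightarrow> 'a) \<Rightarrow> ('a list \<Rightarrow> int) \<Rightarrow> 'a list \<Rightarrow> int" where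
  "prism h f [] = 0"
| "prism h f (x # xs) = f (x # map h (x # xs)) - prism h (\<lambda>ys. f (x # ys)) xs"

lemma prism_diff: "prism h (\<lambda>ys. f ys - f' ys) xs = prism h f xs - prism h f' xs"
  by (induction xs arbitrary: f f') auto

lemma prism_cong:
  assumes "\<And>us x vs. xs = us @ x # vs \<Longrightarrow>
    [f (us @ x # map h (x # vs)) = f' (us @ x # map h (x # vs))] (mod m)"
  shows "[prism h f xs = prism h f' xs] (mod m)"
  using assms
proof (induction xs arbitrary: f f')
  case (Cons x xs)
  have "[prism h (\<lambda>ys. f (x # ys)) xs = prism h (\<lambda>ys. f' (x # ys)) xs] (mod m)"
  proof (rule Cons.IH)
    fix us y vs assume "xs = us @ y # vs"
    then show "[f (x # us @ y # map h (y # vs)) = f' (x # us @ y # map h (y # vs))] (mod m)"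
      using Cons.prems[of "x # us" y vs] by simp
  qed
  moreover have "[f (x # map h (x # xs)) = f' (x # map h (x # xs))] (mod m)"
    using Cons.prems[of "[]" x xs] by simp
  ultimately show ?case by (simp add: cong_diff)
qed simp

text \<open>The chain homotopy identity between the identity and \<open>h\<close>: faces shared by
  neighbouring simplices of the prism cancel, leaving its two ends and its sides.\<close>

lemma prism_cobd: "prism h (cobd f) xs + cobd (prism h f) xs = f (map h xs) - f xs"
proof (induction xs arbitrary: f)
  case (Cons x xs)
  have "prism h (cobd f) (x # xs) = f (map h (x # xs)) - f (x # map h xs)
      + cobd (\<lambda>ys. f (x # h x # ys)) (map h xs)
      - prism h f xs + prism h (cobd (\<lambda>ys. f (x # ys))) xs"
    by (simp add: prism_diff)
  moreover have "cobd (prism h f) (x # xs) = prism h f xs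
      - cobd (\<lambda>ys. f (x # h x # ys)) (map h xs) + cobd (prism h (\<lambda>ys. f (x # ys))) xs"
    by (simp add: cobd_diff cobd_map[of "\<lambda>ys. f (x # h x # ys)"])
  ultimately show ?case
    using Cons.IH[of "\<lambda>ys. f (x # ys)"] by simp
qed simp

text \<open>The homotopy \<open>X \<le> h X \<ge> v\<close> contracts the complex to the vertex \<open>v\<close>.\<close>

definition contr :: "'a \<Rightarrow> ('a \<Rightarrow> 'a) \<Rightarrow> ('a list \<Rightarrow> int) \<Rightarrow> 'a list \<Rightarrow> int" where
  "contr v h f xs = f (v # map h xs) - prism h f xs"

lemma contr_diff: "contr v h (\<lambda>ys. f ys - f' ys) xs = contr v h f xs - contr v h f' xs"
  by (simp add: contr_def prism_diff)

text \<open>Deleting the apex of the cone leaves \<open>f (map h xs)\<close>, which the prism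
  exchanges for \<open>f xs\<close>.\<close>

lemma contr_cobd: "contr v h (cobd f) xs = f xs - cobd (contr v h f) xs"
proof -
  have "cobd (contr v h f) xs = cobd (\<lambda>ys. f (v # ys)) (map h xs) - cobd (prism h f) xs"
    unfolding contr_def by (simp add: cobd_diff cobd_map[of "\<lambda>ys. f (v # ys)"])
  then show ?thesis
    using prism_cobd[of h f xs] by (simp add: contr_def)
qed

section \<open>Signed vectors and the chains at which cochains are evaluated\<close>

text \<open>Serves both for coordinates with a sign and for labels with a sign, so that equivariance
  of a labelling involves a single map.\<close>

definition rot :: "nat \<Rightarrow> nat \<times> nat \<Rightarrow> nat \<times> nat" where
  "rot p = (\<lambda>(i, a). (i, Suc a mod p))"

lemma rot_simp [simp]: "rot p (i, a) = (i, Suc a mod p)"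
  by (simp add: rot_def)

lemma funpow_rot: "a < p \<Longrightarrow> (rot p ^^ m) (i, a) = (i, (a + m) mod p)"
  by (induction m) (simp_all add: mod_Suc_eq)

lemma funpow_image: "((`) f ^^ m) X = (f ^^ m) ` X" for f :: "'a \<Rightarrow> 'a"
  by (induction m) (simp_all add: image_comp)

text \<open>A vector over \<open>\<int>\<^sub>p \<union> {0}\<close> is represented by the set of pairs of a coordinate and its sign.\<close>

definition signed :: "nat \<Rightarrow> nat \<Rightarrow> (nat \<times> nat) set \<Rightarrow> bool" where
  "signed p n X \<longleftrightarrow> X \<noteq> {} \<and> X \<subseteq> {1..n} \<times> {..<p} \<and> single_valued X"

lemma signed_rot:
  assumes "signed p n X"
  shows "signed p n (rot p ` X)"
proof -
  have "p > 0" using assms by (auto simp: signed_def)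
  moreover have "single_valued (rot p ` X)"
  proof (rule single_valuedI)
    fix i a b assume "(i, a) \<in> rot p ` X" "(i, b) \<in> rot p ` X"
    then obtain a' b' where "(i, a') \<in> X" "(i, b') \<in> X" "a = Suc a' mod p" "b = Suc b' mod p"
      by (auto simp: rot_def)
    then show "a = b"
      using assms by (auto simp: signed_def dest: single_valuedD)
  qed
  ultimately show ?thesis
    using assms by (auto simp: signed_def)
qed

lemma signed_funpow_rot: "signed p n X \<Longrightarrow> signed p n (((`) (rot p) ^^ m) X)"
  by (induction m) (simp_all add: signed_rot)

lemma rot_period:
  assumes "signed p n X"
  shows "((`) (rot p) ^^ p) X = X"
proof -
  have "(rot p ^^ p) x = x" if "x \<in> X" for x
    using that assms by (cases x) (auto simp: signed_def funpow_rot)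
  then show ?thesis by (simp add: funpow_image)
qed

lemma signed_mono: "signed p m X \<Longrightarrow> m \<le> n \<Longrightarrow> signed p n X"
  by (fastforce simp: signed_def)

definition flag :: "nat \<Rightarrow> nat \<Rightarrow> (nat \<times> nat) set list \<Rightarrow> bool" where
  "flag p n xs \<longleftrightarrow> sorted_wrt (\<subseteq>) xs \<and> (\<forall>X\<in>set xs. signed p n X)"

lemma flag_map_rot:
  assumes "flag p n xs"
  shows "flag p n (map ((`) (rot p) ^^ m) xs)"
proof -
  have "sorted_wrt (\<subseteq>) (map ((`) (rot p) ^^ m) xs)"
    unfolding sorted_wrt_map
    by (rule sorted_wrt_mono_rel[of xs "(\<subseteq>)"]) (use assms in \<open>auto simp: flag_def funpow_image\<close>)
  then show ?thesis
    using assms by (auto simp: flag_def signed_funpow_rot)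
qed

text \<open>\<open>ev p j\<close> is evaluation at a chain \<open>c\<^sub>j\<close> on flags of length \<open>j\<close>, where \<open>c\<^sub>j\<^sub>+\<^sub>1\<close> is the cone over
  \<open>tau j c\<^sub>j\<close> with apex the unit vector of coordinate \<open>j + 1\<close>.\<close>

primrec ev :: "nat \<Rightarrow> nat \<Rightarrow> ((nat \<times> nat) set list \<Rightarrow> int) \<Rightarrow> int" where
  "ev p 0 = (\<lambda>f. f [])"
| "ev p (Suc j) = (\<lambda>f. ev p j
     (tau p ((`) (rot p)) j (contr {(Suc j, 0)} (insert (Suc j, 0)) f)))"

lemma ev_diff: "ev p j (\<lambda>xs. f xs - f' xs) = ev p j f - ev p j f'"
proof (induction j arbitrary: f f')
  case (Suc j)
  let ?T = "\<lambda>f. tau p ((`) (rot p)) j (contr {(Suc j, 0)} (insert (Suc j, 0)) f)"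
  have "contr {(Suc j, 0)} (insert (Suc j, 0)) (\<lambda>xs. f xs - f' xs) =
     (\<lambda>xs. contr {(Suc j, 0)} (insert (Suc j, 0)) f xs - contr {(Suc j, 0)} (insert (Suc j, 0)) f' xs)"
    by (rule ext) (rule contr_diff)
  then have "?T (\<lambda>xs. f xs - f' xs) = (\<lambda>xs. ?T f xs - ?T f' xs)"
    by (auto simp: tau_diff)
  then show ?case by (simp add: Suc)
qed simp

lemma ev_cong:
  assumes "p > 0" and "\<And>xs. flag p j xs \<Longrightarrow> length xs = j \<Longrightarrow> [f xs = f' xs] (mod m)"
  shows "[ev p j f = ev p j f'] (mod m)"
  using assms(2)
proof (induction j arbitrary: f f')
  case 0
  then show ?case by (simp add: flag_def)
next
  case (Suc j)
  let ?e = "(Suc j, 0) :: nat \<times> nat"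
  have ins: "signed p (Suc j) (insert ?e X)" if "signed p j X" for X
    using that assms(1) unfolding signed_def single_valued_def by fastforce
  have e: "signed p (Suc j) {?e}"
    using assms(1) by (auto simp: signed_def single_valued_def)
  have up: "signed p (Suc j) X" if "signed p j X" for X
    using that signed_mono by simp
  have C: "[contr {?e} (insert ?e) f xs = contr {?e} (insert ?e) f' xs] (mod m)"
    if xs: "flag p j xs" "length xs = j" for xs
    unfolding contr_def
  proof (intro cong_diff prism_cong)
    have "sorted_wrt (\<subseteq>) (map (insert ?e) xs)"
      unfolding sorted_wrt_map
      by (rule sorted_wrt_mono_rel[of xs "(\<subseteq>)"]) (use xs in \<open>auto simp: flag_def\<close>)
    then have "flag p (Suc j) ({?e} # map (insert ?e) xs)"
      using xs ins e by (auto simp: flag_def)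
    then show "[f ({?e} # map (insert ?e) xs) = f' ({?e} # map (insert ?e) xs)] (mod m)"
      using xs by (intro Suc.prems) auto
  next
    fix us x vs assume eq: "xs = us @ x # vs"
    have s: "sorted_wrt (\<subseteq>) us" "sorted_wrt (\<subseteq>) (x # vs)" "\<And>u v. u \<in> set us \<Longrightarrow> v \<in> set (x # vs) \<Longrightarrow> u \<subseteq> v"
      using xs eq by (auto simp: flag_def sorted_wrt_append)
    have "sorted_wrt (\<subseteq>) (map (insert ?e) (x # vs))"
      unfolding sorted_wrt_map
      by (rule sorted_wrt_mono_rel[OF _ s(2)]) auto
    moreover have "x \<subseteq> y" if "y \<in> set (map (insert ?e) (x # vs))" for y
      using that s(2) by auto
    moreover have "u \<subseteq> y" if u: "u \<in> set us" and y: "y \<in> set (map (insert ?e) (x # vs))" for u y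
    proof -
      obtain v where "v \<in> set (x # vs)" "y = insert ?e v"
        using y unfolding set_map by (rule imageE)
      then show ?thesis using s(3)[OF u] by blast
    qed
    ultimately have "sorted_wrt (\<subseteq>) (us @ x # map (insert ?e) (x # vs))"
      using s(1) s(3) by (simp add: sorted_wrt_append)
    then have "flag p (Suc j) (us @ x # map (insert ?e) (x # vs))"
      using xs eq ins up by (auto simp: flag_def)
    then show "[f (us @ x # map (insert ?e) (x # vs)) = f' (us @ x # map (insert ?e) (x # vs))] (mod m)"
      using xs eq by (intro Suc.prems) auto
  qed
  show ?case
    unfolding ev.simps
  proof (rule Suc.IH)
    fix xs assume xs: "flag p j xs" "length xs = j"
    note C' = C[OF flag_map_rot[OF xs(1)]]
    have "[contr {?e} (insert ?e) f (map ((`) (rot p)) xs) = contr {?e} (insert ?e) f' (map ((`) (rot p)) xs)] (mod m)"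
      using C'[of 1] xs by simp
    then show "[tau p ((`) (rot p)) j (contr {?e} (insert ?e) f) xs =
        tau p ((`) (rot p)) j (contr {?e} (insert ?e) f') xs] (mod m)"
      using C' C[OF xs] xs by (cases "j = 0") (simp_all add: tau_def cong_diff cong_sum)
  qed
qed

lemma ev_zero: "ev p j (\<lambda>xs. 0) = 0"
  using ev_diff[of p j "\<lambda>_. 0" "\<lambda>_. 0"] by simp

text \<open>Dually, the boundary of the next chain is \<open>tau j\<close> of the present one. A
  cone has its base as boundary up to the cone over the boundary of the base, and that boundary
  vanishes by the induction hypothesis and \<open>tau_tau\<close>.\<close>

lemma ev_cobd:
  assumes "p > 0"
  shows "ev p (Suc j) (cobd f) = ev p j (tau p ((`) (rot p)) j f)"
proof (induction j arbitrary: f)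
  case 0
  show ?case by (simp add: contr_cobd tau_def)
next
  case (Suc j)
  let ?g = "(`) (rot p)" and ?e = "(Suc (Suc j), 0) :: nat \<times> nat"
  let ?c = "contr {?e} (insert ?e) f"
  have "ev p (Suc (Suc j)) (cobd f) = ev p (Suc j) (tau p ?g (Suc j) (\<lambda>xs. f xs - cobd ?c xs))"
    unfolding ev.simps(2)[of p "Suc j"] by (simp add: contr_cobd[abs_def] del: ev.simps)
  also have "tau p ?g (Suc j) (\<lambda>xs. f xs - cobd ?c xs) =
      (\<lambda>xs. tau p ?g (Suc j) f xs - cobd (tau p ?g (Suc j) ?c) xs)"
    by (auto simp: tau_diff tau_cobd)
  also have "ev p (Suc j) \<dots> = ev p (Suc j) (tau p ?g (Suc j) f) - ev p (Suc j) (cobd (tau p ?g (Suc j) ?c))"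
    by (rule ev_diff)
  also have "ev p (Suc j) (cobd (tau p ?g (Suc j) ?c)) = ev p j (tau p ?g j (tau p ?g (Suc j) ?c))"
    by (rule Suc.IH)
  also have "\<dots> = ev p j (\<lambda>xs. 0)"
  proof -
    \<comment> \<open>Congruence modulo 0 is equality, so \<open>ev_cong\<close> also yields exact
      identities.\<close>
    have "[ev p j (tau p ?g j (tau p ?g (Suc j) ?c)) = ev p j (\<lambda>xs. 0)] (mod 0)"
    proof (rule ev_cong[OF assms])
      fix xs assume "flag p j xs" "length xs = j"
      then show "[tau p ?g j (tau p ?g (Suc j) ?c) xs = 0] (mod 0)"
        by (subst tau_tau) (auto simp: flag_def rot_period)
    qed
    then show ?thesis by simp
  qed
  finally show ?case by (simp add: ev_zero del: ev.simps)
qed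

section \<open>The target complex of labels\<close>

definition colour_class :: "nat \<Rightarrow> (nat \<times> nat) set \<Rightarrow> nat set" where
  "colour_class q S = {a. (q, a) \<in> S}"

text \<open>The join, over all colours \<open>q\<close>, of copies of the boundary of the simplex on
  the \<open>p\<close> signs.\<close>

definition free_sets :: "nat \<Rightarrow> (nat \<times> nat) set set" where
  "free_sets p = {S. S \<noteq> {} \<and> finite S \<and> snd ` S \<subseteq> {..<p} \<and> (\<forall>q. colour_class q S \<noteq> {..<p})}"

text \<open>Rotation adds \<open>card B\<close> to the sum of \<open>B\<close> modulo \<open>p\<close>, and \<open>card B\<close> is invertible because
  \<open>0 < card B < p\<close>.\<close>

definition deg :: "nat \<Rightarrow> (nat \<times> nat) set \<Rightarrow> nat" where
  "deg p S = (let B = colour_class (Min (fst ` S)) S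
     in \<Sum>B * (SOME u. [card B * u = 1] (mod p)) mod p)"

lemma inj_on_Suc_mod: "inj_on (\<lambda>a. Suc a mod p) {..<p}"
  by (rule inj_onI) (auto simp: mod_Suc split: if_splits)

lemma colour_class_rot: "colour_class q (rot p ` S) = (\<lambda>a. Suc a mod p) ` colour_class q S"
  by (force simp: colour_class_def)

lemma colour_class_subset: "snd ` S \<subseteq> {..<p} \<Longrightarrow> colour_class q S \<subseteq> {..<p}"
  by (force simp: colour_class_def)

lemma card_colour_class_rot:
  "snd ` S \<subseteq> {..<p} \<Longrightarrow> card (colour_class q (rot p ` S)) = card (colour_class q S)"
  unfolding colour_class_rot
  by (rule card_image) (rule inj_on_subset[OF inj_on_Suc_mod colour_class_subset])

lemma deg_rot:
  assumes p: "prime p" and S: "S \<in> free_sets p"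
  shows "deg p (rot p ` S) = Suc (deg p S) mod p"
proof -
  define q where "q = Min (fst ` S)"
  define B where "B = colour_class q S"
  have sub: "snd ` S \<subseteq> {..<p}" and fin: "finite S" "S \<noteq> {}" and ne: "B \<noteq> {..<p}"
    using S by (auto simp: free_sets_def B_def)
  have B: "B \<subseteq> {..<p}" using colour_class_subset[OF sub] by (simp add: B_def)
  have "q \<in> fst ` S" using fin by (simp add: q_def)
  then have "B \<noteq> {}" by (force simp: B_def colour_class_def)
  have finB: "finite B" using B finite_subset by blast
  have "card B < p" using psubset_card_mono[of "{..<p}" B] B ne by auto
  moreover have "card B > 0" using \<open>B \<noteq> {}\<close> finB by (simp add: card_gt_0_iff)
  ultimately have "coprime (card B) p"
    using p by (metis coprime_commute nat_dvd_not_less prime_imp_coprime)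
  define u where "u = (SOME u. [card B * u = 1] (mod p))"
  have u: "[card B * u = 1] (mod p)"
    unfolding u_def using cong_solve_coprime_nat[OF \<open>coprime (card B) p\<close>] by (auto intro: someI_ex)
  \<comment> \<open>Rotation moves signs only, so the same least colour is inspected before and
    after.\<close>
  have "fst ` rot p ` S = fst ` S" by (force simp: rot_def)
  then have "deg p (rot p ` S) = (\<Sum>a\<in>B. Suc a mod p) * u mod p"
    using card_colour_class_rot[OF sub, of q] sum.reindex[OF inj_on_subset[OF inj_on_Suc_mod B], of "\<lambda>x. x"]
    by (simp add: deg_def Let_def u_def B_def colour_class_rot flip: q_def)
  also have "\<dots> = (\<Sum>a\<in>B. Suc a) * u mod p"
    unfolding cong_def[symmetric] by (intro cong_mult cong_sum cong_refl) simp
  also have "(\<Sum>a\<in>B. Suc a) * u = \<Sum>B * u + card B * u"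
    by (simp add: sum_Suc algebra_simps)
  also have "(\<Sum>B * u + card B * u) mod p = (\<Sum>B * u + 1) mod p"
    unfolding cong_def[symmetric] using u by (intro cong_add cong_refl)
  finally show ?thesis
    by (simp add: deg_def Let_def u_def B_def q_def mod_Suc_eq)
qed

lemma free_complex_free_sets:
  assumes p: "prime p"
  shows "free_complex p (rot p) (free_sets p) (deg p)"
proof
  show "p > 0" using p by (simp add: prime_gt_0_nat)
  show "T \<in> free_sets p" if "S \<in> free_sets p" "T \<subseteq> S" "T \<noteq> {}" for S T
  proof -
    have "colour_class q T \<noteq> {..<p}" for q
    proof
      assume "colour_class q T = {..<p}"
      then have "{..<p} \<subseteq> colour_class q S" using that(2) by (auto simp: colour_class_def)
      then show False
        using that(1) colour_class_subset[of S p q] by (auto simp: free_sets_def)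
    qed
    then show ?thesis using that by (auto simp: free_sets_def intro: finite_subset)
  qed
  show "rot p ` S \<in> free_sets p" if "S \<in> free_sets p" for S
  proof -
    have S: "snd ` S \<subseteq> {..<p}" using that by (auto simp: free_sets_def)
    have "colour_class q (rot p ` S) \<noteq> {..<p}" for q
    proof
      assume "colour_class q (rot p ` S) = {..<p}"
      then have "card (colour_class q S) = p" using card_colour_class_rot[OF S, of q] by simp
      then have "colour_class q S = {..<p}"
        using card_subset_eq[OF _ colour_class_subset[OF S, of q]] by simp
      then show False using that by (auto simp: free_sets_def)
    qed
    then show ?thesis using that \<open>p > 0\<close> by (auto simp: free_sets_def rot_def)
  qed
  show "(rot p ^^ p) x = x" if "S \<in> free_sets p" "x \<in> S" for S x
    using that by (cases x) (force simp: free_sets_def funpow_rot)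
  show "deg p S < p" for S using \<open>p > 0\<close> by (simp add: deg_def Let_def)
qed (rule deg_rot[OF p])

text \<open>The pullback of \<open>psi j\<close> along \<open>lam\<close> evaluates to 1 modulo
  \<open>p\<close> for every \<open>j\<close> up to \<open>n\<close>: \<open>ev_cobd\<close> turns
  the coboundary into \<open>tau j\<close>, equivariance moves \<open>tau j\<close> across
  \<open>lam\<close>, and there it undoes \<open>theta j\<close>. If every flag of length
  \<open>n\<close> repeated a label, alternation would make the value for \<open>j = n\<close> equal
  to 0.\<close>

theorem Zp_Tucker:
  assumes p: "prime p"
    and equiv: "\<And>X. signed p n X \<Longrightarrow> lam (rot p ` X) = rot p (lam X)"
    and sgn: "\<And>X. signed p n X \<Longrightarrow> snd (lam X) < p"
    and proper: "\<And>xs q. flag p n xs \<Longrightarrow> colour_class q (lam ` set xs) \<noteq> {..<p}"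
  shows "\<exists>xs. flag p n xs \<and> length xs = n \<and> distinct (map lam xs)"
proof (rule ccontr)
  assume contra: "\<not> ?thesis"
  interpret free_complex p "rot p" "free_sets p" "deg p"
    by (rule free_complex_free_sets[OF p])
  let ?g = "(`) (rot p)"
  have equiv': "lam ((?g ^^ i) X) = (rot p ^^ i) (lam X)" if "signed p n X" for i X
    using that by (induction i) (simp_all add: equiv signed_funpow_rot)
  have "[ev p j (\<lambda>xs. psi j (map lam xs)) = 1] (mod int p)" if "j \<le> n" for j
    using that
  proof (induction j)
    case (Suc j)
    have "ev p (Suc j) (\<lambda>xs. psi (Suc j) (map lam xs)) =
        ev p (Suc j) (cobd (\<lambda>xs. theta j (psi j) (map lam xs)))"
      by (simp add: cobd_map[abs_def] del: ev.simps)
    also have "\<dots> = ev p j (tau p ?g j (\<lambda>xs. theta j (psi j) (map lam xs)))"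
      by (rule ev_cobd[OF p_pos])
    also have "[\<dots> = ev p j (\<lambda>xs. psi j (map lam xs))] (mod int p)"
    proof (rule ev_cong[OF p_pos])
      fix xs assume xs: "flag p j xs" "length xs = j"
      then have xsn: "flag p n xs"
        using Suc.prems by (auto simp: flag_def intro: signed_mono)
      then have "map lam (map (?g ^^ i) xs) = map (rot p ^^ i) (map lam xs)" for i
        by (simp add: flag_def equiv')
      from this this[of 1] have "tau p ?g j (\<lambda>xs. theta j (psi j) (map lam xs)) xs =
          tau p (rot p) j (theta j (psi j)) (map lam xs)"
        by (simp add: tau_def del: map_map)
      also have "[\<dots> = psi j (map lam xs)] (mod int p)"
      proof (rule tau_theta_psi)
        assume "map lam xs \<noteq> []"
        then show "set (map lam xs) \<in> free_sets p"
          using proper[OF xsn] sgn xsn by (auto simp: free_sets_def flag_def)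
      qed (simp add: xs)
      finally show "[tau p ?g j (\<lambda>xs. theta j (psi j) (map lam xs)) xs = psi j (map lam xs)] (mod int p)" .
    qed
    also have "[ev p j (\<lambda>xs. psi j (map lam xs)) = 1] (mod int p)"
      using Suc by simp
    finally show ?case .
  qed simp
  from this[of n] have "[ev p n (\<lambda>xs. psi n (map lam xs)) = 1] (mod int p)"
    by simp
  moreover have "[ev p n (\<lambda>xs. psi n (map lam xs)) = ev p n (\<lambda>xs. 0)] (mod int p)"
  proof (rule ev_cong[OF p_pos])
    fix xs assume "flag p n xs" "length xs = n"
    then have "\<not> distinct (map lam xs)" using contra by blast
    then show "[psi n (map lam xs) = 0] (mod int p)"
      by (simp add: alternating_not_distinct[OF alternating_psi])
  qed
  ultimately have "[0 = 1] (mod int p)"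
    by (metis cong_sym cong_trans ev_zero)
  then show False
    using prime_gt_1_nat[OF p] by (simp add: cong_def)
qed

section \<open>Monochromatic edges\<close>

definition sgn_at :: "(nat \<times> nat) set \<Rightarrow> nat \<Rightarrow> nat" where
  "sgn_at X i = (THE a. (i, a) \<in> X)"

lemma sgn_at_eq: "single_valued X \<Longrightarrow> (i, a) \<in> X \<Longrightarrow> sgn_at X i = a"
  unfolding sgn_at_def by (auto dest: single_valuedD)

lemma sgn_at_mem: "single_valued X \<Longrightarrow> i \<in> fst ` X \<Longrightarrow> (i, sgn_at X i) \<in> X"
  using sgn_at_eq by fastforce

lemma sgn_at_rot:
  assumes "signed p n X" "i \<in> fst ` X"
  shows "sgn_at (rot p ` X) i = Suc (sgn_at X i) mod p"
proof (rule sgn_at_eq)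
  show "single_valued (rot p ` X)" using signed_rot[OF assms(1)] by (simp add: signed_def)
  have "(i, sgn_at X i) \<in> X" using assms by (auto simp: signed_def intro: sgn_at_mem)
  then show "(i, Suc (sgn_at X i) mod p) \<in> rot p ` X" by (force simp: rot_def)
qed

definition sign_class :: "nat \<Rightarrow> (nat \<times> nat) set \<Rightarrow> nat set" where
  "sign_class a X = {i. (i, a) \<in> X}"

definition nearly_inside :: "nat \<Rightarrow> nat \<Rightarrow> nat \<Rightarrow> nat \<Rightarrow> (nat \<times> nat) set \<Rightarrow> nat set set" where
  "nearly_inside p n k s X = {A. A \<subseteq> {1..n} \<and> card A = k \<and>
     (\<exists>a<p. A \<inter> fst ` X \<subseteq> sign_class a X \<and> k - s \<le> card (A \<inter> fst ` X))}"

lemma sign_class_rot: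
  assumes "signed p n X" "a < p"
  shows "sign_class (Suc a mod p) (rot p ` X) = sign_class a X"
proof -
  have "(i, a) \<in> X" if i: "(i, Suc a mod p) \<in> rot p ` X" for i
  proof -
    obtain b where b: "(i, b) \<in> X" "Suc a mod p = Suc b mod p"
      using i by (auto simp: rot_def)
    moreover have "b < p" using b(1) assms(1) by (auto simp: signed_def)
    ultimately show ?thesis
      using inj_onD[OF inj_on_Suc_mod b(2)] assms(2) by simp
  qed
  then show ?thesis
    by (force simp: sign_class_def rot_def)
qed

lemma fst_rot: "fst ` rot p ` X = fst ` X"
  by (force simp: rot_def)

text \<open>Rotation permutes the sign classes, and the sign is existentially quantified. A choice
  from this family is therefore constant on orbits, as an equivariant labelling needs.\<close>

lemma nearly_inside_rot:
  assumes "signed p n X"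
  shows "nearly_inside p n k s (rot p ` X) = nearly_inside p n k s X"
proof -
  have "(\<exists>a<p. P (sign_class a (rot p ` X))) \<longleftrightarrow> (\<exists>a<p. P (sign_class a X))" for P
  proof
    assume "\<exists>a<p. P (sign_class a X)"
    then obtain a where "a < p" "P (sign_class a X)" by blast
    then show "\<exists>a<p. P (sign_class a (rot p ` X))"
      using sign_class_rot[OF assms] by (intro exI[of _ "Suc a mod p"]) auto
  next
    assume "\<exists>a<p. P (sign_class a (rot p ` X))"
    then obtain a where a: "a < p" "P (sign_class a (rot p ` X))" by blast
    \<comment> \<open>The cyclic predecessor of \<open>a\<close>.\<close>
    define b where "b = (if a = 0 then p - 1 else a - 1)"
    have "b < p" "Suc b mod p = a" using a by (auto simp: b_def)
    then show "\<exists>a<p. P (sign_class a X)"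
      using sign_class_rot[OF assms, of b] a by auto
  qed
  then have "(\<exists>a<p. A \<inter> fst ` X \<subseteq> sign_class a (rot p ` X) \<and> k - s \<le> card (A \<inter> fst ` X)) \<longleftrightarrow>
      (\<exists>a<p. A \<inter> fst ` X \<subseteq> sign_class a X \<and> k - s \<le> card (A \<inter> fst ` X))" for A
    by (rule meta_spec[of _ "\<lambda>C. A \<inter> fst ` X \<subseteq> C \<and> k - s \<le> card (A \<inter> fst ` X)"])
  then show ?thesis
    unfolding nearly_inside_def fst_rot by simp
qed

lemma signed_finite: "signed p n X \<Longrightarrow> finite X"
  unfolding signed_def by (meson finite_SigmaI finite_atLeastAtMost finite_lessThan finite_subset)

lemma card_fst_signed: "single_valued X \<Longrightarrow> card (fst ` X) = card X"
  by (rule card_image) (auto simp: inj_on_def dest: single_valuedD)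

text \<open>By pigeonhole the largest sign class has at least \<open>k - s\<close> elements; such a
  part of it is completed to a \<open>k\<close>-set from the class and the zeros of
  \<open>X\<close>.\<close>

lemma nearly_inside_nonempty:
  assumes X: "signed p n X" and n: "p * (k - 1) + 1 \<le> n" and "s < k"
    and big: "p * (k - s - 1) < card X"
  shows "nearly_inside p n k s X \<noteq> {}"
proof -
  have p: "p > 0" using X by (auto simp: signed_def)
  have finX: "finite (fst ` X)" using signed_finite[OF X] by simp
  have sub: "sign_class a X \<subseteq> fst ` X" for a by (force simp: sign_class_def)
  then have fin: "finite (sign_class a X)" for a using finX finite_subset by blast
  have "Max ((\<lambda>a. card (sign_class a X)) ` {..<p}) \<in> (\<lambda>a. card (sign_class a X)) ` {..<p}"
    using p by (intro Max_in) auto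
  then obtain a where a: "a < p" "card (sign_class a X) = Max ((\<lambda>a. card (sign_class a X)) ` {..<p})"
    by auto
  have max: "card (sign_class b X) \<le> card (sign_class a X)" if "b < p" for b
    using a that by simp
  have "fst ` X = (\<Union>b<p. sign_class b X)"
    using X by (force simp: sign_class_def signed_def)
  moreover have "card (\<Union>b<p. sign_class b X) = (\<Sum>b<p. card (sign_class b X))"
    using X fin by (intro card_UN_disjoint) (auto simp: sign_class_def signed_def dest: single_valuedD)
  ultimately have card: "card X = (\<Sum>b<p. card (sign_class b X))"
    using card_fst_signed[of X] X by (simp add: signed_def)
  have "card X \<le> p * card (sign_class a X)"
    unfolding card using sum_bounded_above[of "{..<p}" "\<lambda>b. card (sign_class b X)" "card (sign_class a X)"] max by simp
  then have large: "k - s \<le> card (sign_class a X)"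
  proof -
    have "p * (k - s - 1) < p * card (sign_class a X)"
      using big \<open>card X \<le> _\<close> by linarith
    then show ?thesis by auto
  qed
  define Z where "Z = {1..n} - fst ` X"
  have finZ: "finite Z" by (simp add: Z_def)
  have "fst ` X \<subseteq> {1..n}" using X by (auto simp: signed_def)
  then have cZ: "card Z + card X = n"
    using card_fst_signed[of X] X card_Diff_subset[OF finX, of "{1..n}"] card_mono[of "{1..n}" "fst ` X"]
    by (simp add: Z_def signed_def)
  have "card (sign_class a X \<union> Z) = card (sign_class a X) + card Z"
    using sub[of a] fin finZ by (intro card_Un_disjoint) (auto simp: Z_def)
  moreover have "k \<le> card (sign_class a X) + card Z"
  \<comment> \<open>If the largest class has fewer than \<open>k\<close> elements, the other
    \<open>p - 1\<close> classes cover at most \<open>(p - 1) * (k - 1)\<close> coordinates. By the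
    bound on \<open>n\<close> at least \<open>k\<close> remain for this class and the zeros.\<close>
  proof (cases "k \<le> card (sign_class a X)")
    case False
    have "card X = card (sign_class a X) + (\<Sum>b\<in>{..<p} - {a}. card (sign_class b X))"
      unfolding card using a by (simp add: sum.remove)
    also have "(\<Sum>b\<in>{..<p} - {a}. card (sign_class b X)) \<le> (p - 1) * (k - 1)"
      using sum_bounded_above[of "{..<p} - {a}" "\<lambda>b. card (sign_class b X)" "k - 1"] max False a(1)
      by (auto simp: le_diff_conv2) (meson Suc_leI less_le_trans not_less order.trans)
    finally have "card X \<le> card (sign_class a X) + (p - 1) * (k - 1)" by simp
    moreover have "p * (k - 1) = (p - 1) * (k - 1) + (k - 1)"
      using p by (simp add: mult_eq_if)
    ultimately show ?thesis using cZ n \<open>s < k\<close> by linarith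
  qed simp
  ultimately have "k \<le> card (sign_class a X \<union> Z)" by simp
  moreover obtain B where B: "B \<subseteq> sign_class a X" "card B = k - s"
    using obtain_subset_with_card_n[OF large] by metis
  ultimately obtain A where A: "B \<subseteq> A" "A \<subseteq> sign_class a X \<union> Z" "card A = k"
    using exists_subset_between[of B k "sign_class a X \<union> Z"] fin finZ by auto
  have "A \<inter> fst ` X \<subseteq> sign_class a X" using A(2) by (auto simp: Z_def)
  moreover have "B \<subseteq> A \<inter> fst ` X" using A B sub by blast
  then have "k - s \<le> card (A \<inter> fst ` X)"
    using B(2) finX card_mono[of "A \<inter> fst ` X" B] by simp
  moreover have "A \<subseteq> {1..n}"
    using A(2) sub[of a] \<open>fst ` X \<subseteq> {1..n}\<close> unfolding Z_def by blast
  ultimately show ?thesis using A(3) a(1) by (auto simp: nearly_inside_def)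
qed

text \<open>On the support of \<open>X\<close> the signs of \<open>X\<close> and \<open>Y\<close>
  agree, so an element of \<open>A\<close> there has sign \<open>a\<close>, whereas \<open>B\<close>
  admits only \<open>b\<close>. Hence \<open>B\<close> meets \<open>A\<close> only outside that
  support, in at most \<open>k - (k - s)\<close> elements.\<close>

lemma nearly_inside_inter:
  assumes XY: "X \<subseteq> Y" "single_valued Y"
    and A: "A \<in> nearly_inside p n k s X" "A \<inter> fst ` X \<subseteq> sign_class a X"
    and B: "B \<inter> fst ` Y \<subseteq> sign_class b Y"
    and "a \<noteq> b" "s < k"
  shows "card (A \<inter> B) \<le> s"
proof -
  have "A \<inter> fst ` X \<inter> B = {}"
  proof (rule ccontr)
    assume "A \<inter> fst ` X \<inter> B \<noteq> {}"
    then obtain i where i: "i \<in> A" "i \<in> fst ` X" "i \<in> B" by auto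
    have "(i, a) \<in> Y" using A(2) i XY(1) by (auto simp: sign_class_def)
    moreover have "(i, b) \<in> Y" using B i XY(1) by (force simp: sign_class_def)
    ultimately show False using XY(2) \<open>a \<noteq> b\<close> by (auto dest: single_valuedD)
  qed
  then have "A \<inter> B \<subseteq> A - A \<inter> fst ` X" by auto
  moreover have fin: "finite A" using A(1) by (auto simp: nearly_inside_def intro: finite_subset)
  ultimately have "card (A \<inter> B) \<le> card (A - A \<inter> fst ` X)"
    by (intro card_mono) auto
  also have "\<dots> = card A - card (A \<inter> fst ` X)"
    using fin by (intro card_Diff_subset) auto
  also have "\<dots> \<le> s" using A(1) \<open>s < k\<close> by (auto simp: nearly_inside_def)
  finally show ?thesis .
qed

section \<open>Monochromatic edges of prime size\<close>

text \<open>Formulated for an arbitrary ground set because the product argument applies it inside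
  subsets.\<close>

definition forces_edge :: "nat \<Rightarrow> nat set \<Rightarrow> nat \<Rightarrow> nat \<Rightarrow> nat \<Rightarrow> bool" where
  "forces_edge r V k s t \<longleftrightarrow>
     (\<forall>c. (\<forall>A. A \<subseteq> V \<and> card A = k \<longrightarrow> c A \<in> {1..t}) \<longrightarrow>
       (\<exists>e q. e \<subseteq> {A. A \<subseteq> V \<and> card A = k} \<and> card e = r \<and>
         (\<forall>A\<in>e. \<forall>B\<in>e. A \<noteq> B \<longrightarrow> card (A \<inter> B) \<le> s) \<and> (\<forall>A\<in>e. c A = q)))"

lemma forces_edge_prime:
  assumes p: "prime p" and n: "p * (k - 1) + 1 \<le> n" and "s < k"
    and big: "p * (k - s - 1) + (p - 1) * t < n"
  shows "forces_edge p {1..n} k s t"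
  unfolding forces_edge_def
proof (intro allI impI, rule ccontr)
  fix c :: "nat set \<Rightarrow> nat"
  assume "\<forall>A. A \<subseteq> {1..n} \<and> card A = k \<longrightarrow> c A \<in> {1..t}"
  then have col: "c A \<in> {1..t}" if "A \<subseteq> {1..n}" "card A = k" for A
    using that by blast
  assume contra: "\<not> (\<exists>e q. e \<subseteq> {A. A \<subseteq> {1..n} \<and> card A = k} \<and> card e = p \<and>
         (\<forall>A\<in>e. \<forall>B\<in>e. A \<noteq> B \<longrightarrow> card (A \<inter> B) \<le> s) \<and> (\<forall>A\<in>e. c A = q))"
  define F where "F = nearly_inside p n k s"
  define ch where "ch X = (SOME A. A \<in> F X)" for X
  define \<alpha> where "\<alpha> = p * (k - s - 1)"
  \<comment> \<open>Colours are shifted by \<alpha> to keep them apart from cardinalities. The sign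
    is read at the least element of a set that rotation does not change, so it rotates along with
    \<open>X\<close>.\<close>
  define lam where "lam X = (if F X = {} then (card X, sgn_at X (Min (fst ` X)))
     else (\<alpha> + c (ch X), sgn_at X (Min (ch X \<inter> fst ` X))))" for X
  have p1: "p > 1" using p by (rule prime_gt_1_nat)
  have ch: "ch X \<in> F X" if "F X \<noteq> {}" for X
    using that unfolding ch_def by (simp add: some_in_eq)
  have small: "card X \<le> \<alpha>" "card X > 0" if "F X = {}" "signed p n X" for X
    using that nearly_inside_nonempty[OF that(2) n \<open>s < k\<close>] signed_finite[OF that(2)]
    by (auto simp: F_def \<alpha>_def not_less card_gt_0_iff signed_def)
  have col': "c (ch X) \<in> {1..t}" if "F X \<noteq> {}" for X
    using col ch[OF that] by (auto simp: F_def nearly_inside_def)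
  have FD: "ch X \<inter> fst ` X \<noteq> {} \<and> finite (ch X \<inter> fst ` X)" if "F X \<noteq> {}" "signed p n X" for X
  proof -
    have "k - s \<le> card (ch X \<inter> fst ` X)" using ch[OF that(1)] by (auto simp: F_def nearly_inside_def)
    then show ?thesis using \<open>s < k\<close> signed_finite[OF that(2)] by auto
  qed
  define M where "M X = Min (if F X = {} then fst ` X else ch X \<inter> fst ` X)" for X
  have M: "M X \<in> fst ` X" if "signed p n X" for X
  proof (cases "F X = {}")
    case True
    then show ?thesis using that signed_finite[OF that] by (auto simp: M_def signed_def)
  next
    case False
    then show ?thesis using FD[OF False that] Min_in[of "ch X \<inter> fst ` X"] by (auto simp: M_def)
  qed
  have snd_lam: "snd (lam X) = sgn_at X (M X)" for X by (simp add: lam_def M_def)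
  have Mlam: "(M X, snd (lam X)) \<in> X" if "signed p n X" for X
    using sgn_at_mem[OF _ M[OF that]] that by (simp add: snd_lam signed_def)
  have ch_sign: "ch X \<inter> fst ` X \<subseteq> sign_class (snd (lam X)) X" if "F X \<noteq> {}" "signed p n X" for X
  proof -
    obtain a where a: "ch X \<inter> fst ` X \<subseteq> sign_class a X"
      using ch[OF \<open>F X \<noteq> {}\<close>] by (auto simp: F_def nearly_inside_def)
    have "M X \<in> ch X \<inter> fst ` X" using FD[OF that] Min_in[of "ch X \<inter> fst ` X"] that by (auto simp: M_def)
    then have "(M X, a) \<in> X" using a by (auto simp: sign_class_def)
    then have "a = snd (lam X)" using Mlam[OF that(2)] that(2) by (auto simp: signed_def dest: single_valuedD)
    then show ?thesis using a by simp
  qed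
  have no_full: "colour_class q (lam ` set xs) \<noteq> {..<p}" if xs: "flag p n xs" for xs q
  proof
    assume full: "colour_class q (lam ` set xs) = {..<p}"
    have "\<exists>X\<in>set xs. lam X = (q, a)" if "a < p" for a
    proof -
      have "a \<in> colour_class q (lam ` set xs)" using full that by simp
      then show ?thesis by (force simp: colour_class_def)
    qed
    then obtain Y where Y: "\<And>a. a < p \<Longrightarrow> Y a \<in> set xs" "\<And>a. a < p \<Longrightarrow> lam (Y a) = (q, a)"
      by metis
    have sY: "signed p n (Y a)" if "a < p" for a
      using Y(1)[OF that] xs by (auto simp: flag_def)
    have comp: "X \<subseteq> X' \<or> X' \<subseteq> X" if "X \<in> set xs" "X' \<in> set xs" for X X'
    proof -
      obtain i j where "i < length xs" "j < length xs" "X = xs ! i" "X' = xs ! j"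
        using \<open>X \<in> set xs\<close> \<open>X' \<in> set xs\<close> by (auto simp: in_set_conv_nth)
      then show ?thesis
        using xs by (cases i j rule: linorder_cases) (auto simp: flag_def sorted_wrt_iff_nth_less)
    qed
    show False
    proof (cases "q \<le> \<alpha>")
      case True
      \<comment> \<open>Colours are at least 1, so a value up to \<alpha> can only be a cardinality.
        Comparable vectors of equal size coincide and cannot carry two signs.\<close>
      have "card (Y a) = q" if "a < p" for a
        using Y(2)[OF that] col'[of "Y a"] True by (auto simp: lam_def split: if_splits)
      then have "Y 0 = Y 1"
        using comp[OF Y(1)[of 0] Y(1)[of 1]] p1 card_subset_eq signed_finite[OF sY[of 0]] signed_finite[OF sY[of 1]]
        by (metis less_trans zero_less_one)
      then show False using Y(2)[of 0] Y(2)[of 1] p1 by simp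
    next
      case False
      have ne: "F (Y a) \<noteq> {}" if "a < p" for a
        using Y(2)[OF that] small(1)[OF _ sY[OF that]] False by (auto simp: lam_def)
      have cY: "c (ch (Y a)) = q - \<alpha>" if "a < p" for a
        using Y(2)[OF that] ne[OF that] by (auto simp: lam_def)
      have V: "ch (Y a) \<subseteq> {1..n} \<and> card (ch (Y a)) = k" if "a < p" for a
        using ch[OF ne[OF that]] by (auto simp: F_def nearly_inside_def)
      have sc: "ch (Y a) \<inter> fst ` Y a \<subseteq> sign_class a (Y a)" if "a < p" for a
        using ch_sign[OF ne[OF that] sY[OF that]] Y(2)[OF that] by simp
      have le: "card (ch (Y a) \<inter> ch (Y b)) \<le> s" if "a < p" "b < p" "a \<noteq> b" "Y a \<subseteq> Y b" for a b
        using nearly_inside_inter[OF that(4) _ _ sc[OF that(1)] sc[OF that(2)] that(3) \<open>s < k\<close>]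
          sY[OF that(2)] ch[OF ne[OF that(1)]] by (auto simp: F_def signed_def)
      have inter: "card (ch (Y a) \<inter> ch (Y b)) \<le> s" if "a < p" "b < p" "a \<noteq> b" for a b
        using comp[OF Y(1)[OF that(1)] Y(1)[OF that(2)]] le[of a b] le[of b a] that
        by (auto simp: Int_commute)
      \<comment> \<open>Equal sets would meet in \<open>k > s\<close> elements, so the
        \<open>p\<close> signs give \<open>p\<close> distinct vertices.\<close>
      have "inj_on (\<lambda>a. ch (Y a)) {..<p}"
      proof (rule inj_onI, rule ccontr)
        fix a b assume "a \<in> {..<p}" "b \<in> {..<p}" "ch (Y a) = ch (Y b)" "a \<noteq> b"
        then show False using inter[of a b] V[of b] \<open>s < k\<close> by auto
      qed
      define e where "e = (\<lambda>a. ch (Y a)) ` {..<p}"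
      have e1: "e \<subseteq> {A. A \<subseteq> {1..n} \<and> card A = k}"
        using V by (auto simp: e_def)
      have e2: "card e = p"
        using card_image[OF \<open>inj_on _ {..<p}\<close>] by (simp add: e_def)
      have e3: "\<forall>A\<in>e. \<forall>B\<in>e. A \<noteq> B \<longrightarrow> card (A \<inter> B) \<le> s"
      proof (intro ballI impI)
        fix A B assume "A \<in> e" "B \<in> e" "A \<noteq> B"
        then obtain a b where "a < p" "b < p" "A = ch (Y a)" "B = ch (Y b)"
          by (auto simp: e_def)
        then show "card (A \<inter> B) \<le> s" using inter[of a b] \<open>A \<noteq> B\<close> by auto
      qed
      have e4: "\<forall>A\<in>e. c A = q - \<alpha>"
        using cY by (auto simp: e_def)
      show False
        by (rule notE[OF contra], rule exI[of _ e], rule exI[of _ "q - \<alpha>"]) (intro conjI e1 e2 e3 e4)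
    qed
  qed
  have rotF: "F (rot p ` X) = F X" if "signed p n X" for X
    using nearly_inside_rot[OF that] by (simp add: F_def)
  have "\<exists>xs. flag p n xs \<and> length xs = n \<and> distinct (map lam xs)"
  proof (rule Zp_Tucker[OF p _ _ no_full])
    fix X assume X: "signed p n X"
    have "inj_on (rot p) X"
    proof (rule inj_onI)
      fix x y assume xy: "x \<in> X" "y \<in> X" "rot p x = rot p y"
      then have "fst x = fst y" by (auto simp: rot_def split: prod.splits)
      then show "x = y"
        using xy X unfolding signed_def by (metis prod.collapse single_valuedD)
    qed
    then have "card (rot p ` X) = card X" by (rule card_image)
    moreover have "ch (rot p ` X) = ch X" by (simp add: ch_def rotF[OF X])
    moreover have "sgn_at (rot p ` X) (M X) = Suc (sgn_at X (M X)) mod p"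
      by (rule sgn_at_rot[OF X M[OF X]])
    ultimately show "lam (rot p ` X) = rot p (lam X)"
      by (simp add: lam_def rotF[OF X] fst_rot M_def split: if_splits)
    show "snd (lam X) < p" using Mlam[OF X] X by (auto simp: signed_def)
  qed
  then obtain xs where xs: "flag p n xs" "length xs = n" "distinct (map lam xs)" by blast
  define S where "S = lam ` set xs"
  have "card S = n" using distinct_card[OF xs(3)] xs(2) by (simp add: S_def)
  have sg: "signed p n X" if "X \<in> set xs" for X using xs(1) that by (auto simp: flag_def)
  have sub: "colour_class q S \<subseteq> {..<p}" for q
  proof
    fix a assume "a \<in> colour_class q S"
    then obtain X where X: "X \<in> set xs" "lam X = (q, a)"
      unfolding colour_class_def S_def by (metis (mono_tags) imageE mem_Collect_eq)
    then show "a \<in> {..<p}"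
      using Mlam[OF sg[OF X(1)]] sg[OF X(1)] by (auto simp: signed_def)
  qed
  have S: "S = (SIGMA q:{1..\<alpha> + t}. colour_class q S)"
  proof -
    have "fst (lam X) \<in> {1..\<alpha> + t}" if "X \<in> set xs" for X
      using small[OF _ sg[OF that]] col'[of X] by (auto simp: lam_def Suc_le_eq)
    then have "q \<in> {1..\<alpha> + t}" if "(q, a) \<in> S" for q a
      using that unfolding S_def by (metis fst_conv imageE)
    then show ?thesis
      by (auto simp: colour_class_def simp del: atLeastAtMost_iff)
  qed
  \<comment> \<open>Counting labels by first component: a cardinality occurs with at most one sign
    along the chain, a shifted colour with at most \<open>p - 1\<close>.\<close>
  have "card S = (\<Sum>q\<in>{1..\<alpha> + t}. card (colour_class q S))"
    by (subst S, rule card_SigmaI) (auto intro: finite_subset[OF sub])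
  also have "\<dots> = (\<Sum>q\<in>{1..\<alpha>}. card (colour_class q S)) + (\<Sum>q\<in>{\<alpha><..\<alpha> + t}. card (colour_class q S))"
    by (subst sum.union_disjoint[symmetric]) (auto intro!: sum.cong)
  also have "(\<Sum>q\<in>{1..\<alpha>}. card (colour_class q S)) \<le> card {1..\<alpha>} * 1"
  proof (rule sum_bounded_above[THEN order_trans])
    fix q assume q: "q \<in> {1..\<alpha>}"
    have uniq: "X = X'" if "X \<in> set xs" "X' \<in> set xs" "fst (lam X) = q" "fst (lam X') = q" for X X'
    proof -
      have "card X = q" "card X' = q"
        using that q col'[of X] col'[of X'] by (auto simp: lam_def split: if_splits)
      moreover obtain i j where "i < length xs" "j < length xs" "X = xs ! i" "X' = xs ! j"
        using \<open>X \<in> set xs\<close> \<open>X' \<in> set xs\<close> by (auto simp: in_set_conv_nth)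
      then have "X \<subseteq> X' \<or> X' \<subseteq> X"
        using xs(1) by (cases i j rule: linorder_cases) (auto simp: flag_def sorted_wrt_iff_nth_less)
      ultimately show ?thesis
        using card_subset_eq signed_finite[OF sg] that by metis
    qed
    have "a = b" if "a \<in> colour_class q S" "b \<in> colour_class q S" for a b
    proof -
      have "(q, a) \<in> lam ` set xs" "(q, b) \<in> lam ` set xs"
        using that by (simp_all add: colour_class_def S_def)
      then obtain X X' where X: "X \<in> set xs" "X' \<in> set xs" "(q, a) = lam X" "(q, b) = lam X'"
        by blast
      then have "X = X'" using uniq[OF X(1,2)] by (metis fst_conv)
      then show ?thesis using X by (metis snd_conv)
    qed
    then show "card (colour_class q S) \<le> 1"
      using card_le_Suc0_iff_eq[of "colour_class q S"] finite_subset[OF sub] by auto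
  qed simp
  also have "(\<Sum>q\<in>{\<alpha><..\<alpha> + t}. card (colour_class q S)) \<le> card {\<alpha><..\<alpha> + t} * (p - 1)"
  proof (rule sum_bounded_above[THEN order_trans])
    fix q
    have "colour_class q S \<subset> {..<p}" using sub no_full[OF xs(1)] by (auto simp: S_def)
    then have "card (colour_class q S) < p" using psubset_card_mono[of "{..<p}" "colour_class q S"] by simp
    then show "card (colour_class q S) \<le> p - 1" by simp
  qed simp
  finally have "card S \<le> \<alpha> + t * (p - 1)" by simp
  then show False using \<open>card S = n\<close> big by (simp add: \<alpha>_def mult.commute)
qed

section \<open>From prime to composite edge size\<close>

lemma forces_edgeE:
  assumes "forces_edge r V k s t" "\<And>A. A \<subseteq> V \<Longrightarrow> card A = k \<Longrightarrow> c A \<in> {1..t}"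
  obtains e q where "e \<subseteq> {A. A \<subseteq> V \<and> card A = k}" "card e = r"
    "\<And>A B. A \<in> e \<Longrightarrow> B \<in> e \<Longrightarrow> A \<noteq> B \<Longrightarrow> card (A \<inter> B) \<le> s" "\<And>A. A \<in> e \<Longrightarrow> c A = q"
proof -
  have "\<forall>A. A \<subseteq> V \<and> card A = k \<longrightarrow> c A \<in> {1..t}" using assms(2) by blast
  then have "\<exists>e q. e \<subseteq> {A. A \<subseteq> V \<and> card A = k} \<and> card e = r \<and>
      (\<forall>A\<in>e. \<forall>B\<in>e. A \<noteq> B \<longrightarrow> card (A \<inter> B) \<le> s) \<and> (\<forall>A\<in>e. c A = q)"
    by (rule assms(1)[unfolded forces_edge_def, THEN spec, THEN mp])
  then show ?thesis
    by (elim exE conjE, intro that) auto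
qed

lemma forces_edge_bij:
  assumes "forces_edge r U k s t" "bij_betw f U V"
  shows "forces_edge r V k s t"
  unfolding forces_edge_def
proof (intro allI impI)
  fix c :: "nat set \<Rightarrow> nat"
  assume c: "\<forall>A. A \<subseteq> V \<and> card A = k \<longrightarrow> c A \<in> {1..t}"
  have inj: "inj_on f U" and im: "f ` U = V" using assms(2) by (auto simp: bij_betw_def)
  have card: "card (f ` A) = card A" if "A \<subseteq> U" for A
    using inj that by (meson card_image inj_on_subset)
  have col: "c (f ` A) \<in> {1..t}" if "A \<subseteq> U" "card A = k" for A
  proof -
    have "f ` A \<subseteq> V \<and> card (f ` A) = k" using that card im by auto
    then show ?thesis using c by blast
  qed
  obtain e q where e: "e \<subseteq> {A. A \<subseteq> U \<and> card A = k}" "card e = r"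
      "\<And>A B. A \<in> e \<Longrightarrow> B \<in> e \<Longrightarrow> A \<noteq> B \<Longrightarrow> card (A \<inter> B) \<le> s" "\<And>A. A \<in> e \<Longrightarrow> c (f ` A) = q"
    using forces_edgeE[of r U k s t "\<lambda>A. c (f ` A)", OF assms(1) col] by blast
  have eU: "A \<subseteq> U" "card A = k" if "A \<in> e" for A
    using e(1) that by auto
  have "inj_on ((`) f) e"
    using inj_on_subset[OF inj_on_image_Pow[OF inj]] eU by blast
  then have "card ((`) f ` e) = r" using e(2) by (simp add: card_image)
  moreover have "(`) f ` e \<subseteq> {A. A \<subseteq> V \<and> card A = k}"
  proof
    fix B assume "B \<in> (`) f ` e"
    then obtain A where "A \<in> e" "B = f ` A" by blast
    then show "B \<in> {A. A \<subseteq> V \<and> card A = k}"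
      using eU[of A] card[of A] im by auto
  qed
  moreover have "card (f ` A \<inter> f ` B) \<le> s" if "A \<in> e" "B \<in> e" "f ` A \<noteq> f ` B" for A B
  proof -
    have "f ` A \<inter> f ` B = f ` (A \<inter> B)"
      using inj_on_image_Int[OF inj] eU that by blast
    moreover have "card (f ` (A \<inter> B)) = card (A \<inter> B)"
      using card eU[OF that(1)] by blast
    moreover have "A \<noteq> B" using that(3) by blast
    ultimately show ?thesis using e(3)[OF that(1,2)] by simp
  qed
  ultimately show "\<exists>e q. e \<subseteq> {A. A \<subseteq> V \<and> card A = k} \<and> card e = r \<and>
      (\<forall>A\<in>e. \<forall>B\<in>e. A \<noteq> B \<longrightarrow> card (A \<inter> B) \<le> s) \<and> (\<forall>A\<in>e. c A = q)"
    using e(4) by (intro exI[of _ "(`) f ` e"] exI[of _ q] conjI) auto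
qed

lemma forces_edge_mono:
  assumes "forces_edge r V k s t" "s \<le> s'"
  shows "forces_edge r V k s' t"
  unfolding forces_edge_def
proof (intro allI impI)
  fix c :: "nat set \<Rightarrow> nat"
  assume "\<forall>A. A \<subseteq> V \<and> card A = k \<longrightarrow> c A \<in> {1..t}"
  then have col: "c A \<in> {1..t}" if "A \<subseteq> V" "card A = k" for A
    using that by blast
  obtain e q where e: "e \<subseteq> {A. A \<subseteq> V \<and> card A = k}" "card e = r"
      "\<And>A B. A \<in> e \<Longrightarrow> B \<in> e \<Longrightarrow> A \<noteq> B \<Longrightarrow> card (A \<inter> B) \<le> s" "\<And>A. A \<in> e \<Longrightarrow> c A = q"
    using forces_edgeE[of r V k s t c, OF assms(1) col] by blast
  have e3: "\<forall>A\<in>e. \<forall>B\<in>e. A \<noteq> B \<longrightarrow> card (A \<inter> B) \<le> s'"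
    using e(3) assms(2) by (intro ballI impI) (rule order_trans)
  have e4: "\<forall>A\<in>e. c A = q" using e(4) by (rule ballI)
  show "\<exists>e q. e \<subseteq> {A. A \<subseteq> V \<and> card A = k} \<and> card e = r \<and>
      (\<forall>A\<in>e. \<forall>B\<in>e. A \<noteq> B \<longrightarrow> card (A \<inter> B) \<le> s') \<and> (\<forall>A\<in>e. c A = q)"
    by (intro exI[of _ e] exI[of _ q] conjI e(1,2) e3 e4)
qed

text \<open>Members of edges chosen in different blocks meet inside the intersection of the blocks,
  hence in at most \<open>s'\<close> elements. As \<open>s < k\<close>, those edges are disjoint
  families, and their union has \<open>a * b\<close> members.\<close>

lemma forces_edge_mult:
  assumes inner: "\<And>W. W \<subseteq> V \<Longrightarrow> card W = m \<Longrightarrow> forces_edge a W k s t"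
    and outer: "forces_edge b V m s' t"
    and "finite V" "s' \<le> s" "s < k" "a > 0"
  shows "forces_edge (a * b) V k s t"
  unfolding forces_edge_def
proof (intro allI impI)
  fix c :: "nat set \<Rightarrow> nat"
  assume c: "\<forall>A. A \<subseteq> V \<and> card A = k \<longrightarrow> c A \<in> {1..t}"
  define good where "good W e q \<longleftrightarrow> e \<subseteq> {A. A \<subseteq> W \<and> card A = k} \<and> card e = a \<and>
      (\<forall>A\<in>e. \<forall>B\<in>e. A \<noteq> B \<longrightarrow> card (A \<inter> B) \<le> s) \<and> (\<forall>A\<in>e. c A = q)" for W e q
  have "\<exists>e q. good W e q" if W: "W \<subseteq> V \<and> card W = m" for W
  proof -
    have "\<forall>A. A \<subseteq> W \<and> card A = k \<longrightarrow> c A \<in> {1..t}"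
    proof (intro allI impI)
      fix A assume "A \<subseteq> W \<and> card A = k"
      then have "A \<subseteq> V \<and> card A = k" using W by blast
      then show "c A \<in> {1..t}" using c by blast
    qed
    then show ?thesis
      unfolding good_def
      using W by (intro inner[of W, unfolded forces_edge_def, THEN spec, THEN mp]) auto
  qed
  then obtain E Q where "\<And>W. W \<subseteq> V \<and> card W = m \<Longrightarrow> good W (E W) (Q W)"
    by metis
  note EQ = this[unfolded good_def]
  have col: "Q W \<in> {1..t}" if W: "W \<subseteq> V" "card W = m" for W
  proof -
    note W = conjI[OF W]
    \<comment> \<open>The common colour of an empty family would be arbitrary; \<open>a > 0\<close>
      ties \<open>Q W\<close> to an actual value of \<open>c\<close>.\<close>
    have "E W \<noteq> {}" using EQ[OF W] \<open>a > 0\<close> by auto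
    then obtain A where A: "A \<in> E W" by blast
    have "A \<subseteq> V \<and> card A = k" "c A = Q W" using EQ[OF W] A W by blast+
    then show ?thesis using c by metis
  qed
  obtain e q where e: "e \<subseteq> {A. A \<subseteq> V \<and> card A = m}" "card e = b"
      "\<And>A B. A \<in> e \<Longrightarrow> B \<in> e \<Longrightarrow> A \<noteq> B \<Longrightarrow> card (A \<inter> B) \<le> s'" "\<And>A. A \<in> e \<Longrightarrow> Q A = q"
    using forces_edgeE[of b V m s' t Q, OF outer col] by blast
  have WV: "W \<subseteq> V" and cW: "card W = m" if "W \<in> e" for W
    using e(1) that by auto
  have EW: "E W \<subseteq> {A. A \<subseteq> W \<and> card A = k}" "card (E W) = a"
    "\<And>A B. A \<in> E W \<Longrightarrow> B \<in> E W \<Longrightarrow> A \<noteq> B \<Longrightarrow> card (A \<inter> B) \<le> s"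
    "\<And>A. A \<in> E W \<Longrightarrow> c A = q" if "W \<in> e" for W
    using EQ[OF conjI[OF WV[OF that] cW[OF that]]] e(4)[OF that] by simp_all
  have cross: "card (A \<inter> B) \<le> s" if "W \<in> e" "W' \<in> e" "W \<noteq> W'" "A \<in> E W" "B \<in> E W'" for W W' A B
  proof -
    have "A \<inter> B \<subseteq> W \<inter> W'" using EW(1)[OF that(1)] EW(1)[OF that(2)] that by blast
    moreover have "finite (W \<inter> W')" using WV[OF that(1)] \<open>finite V\<close> finite_subset by blast
    ultimately have "card (A \<inter> B) \<le> card (W \<inter> W')" by (rule card_mono[rotated])
    then show ?thesis using e(3)[OF that(1,2,3)] \<open>s' \<le> s\<close> by simp
  qed
  have "e \<subseteq> Pow V" using e(1) by blast
  then have fin: "finite e" using \<open>finite V\<close> finite_subset by blast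
  have finE: "finite (E W)" if "W \<in> e" for W
    using EW(2)[OF that] \<open>a > 0\<close> card_gt_0_iff by fastforce
  have disj: "E W \<inter> E W' = {}" if "W \<in> e" "W' \<in> e" "W \<noteq> W'" for W W'
  proof (rule ccontr)
    assume "E W \<inter> E W' \<noteq> {}"
    then obtain A where A: "A \<in> E W" "A \<in> E W'" by blast
    have "card A = k" using EW(1)[OF that(1)] A by blast
    then show False using cross[OF that A] \<open>s < k\<close> by simp
  qed
  define d where "d = (\<Union>W\<in>e. E W)"
  have d1: "d \<subseteq> {A. A \<subseteq> V \<and> card A = k}"
    using EW(1) WV unfolding d_def by blast
  have "card d = (\<Sum>W\<in>e. card (E W))"
    unfolding d_def using fin finE disj by (intro card_UN_disjoint) auto
  also have "\<dots> = a * b" using EW(2) e(2) by simp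
  finally have d2: "card d = a * b" .
  have d3: "\<forall>A\<in>d. \<forall>B\<in>d. A \<noteq> B \<longrightarrow> card (A \<inter> B) \<le> s"
  proof (intro ballI impI)
    fix A B assume "A \<in> d" "B \<in> d" and ne: "A \<noteq> B"
    then obtain W W' where W: "W \<in> e" "W' \<in> e" "A \<in> E W" "B \<in> E W'"
      unfolding d_def by blast
    show "card (A \<inter> B) \<le> s"
    proof (cases "W = W'")
      case True
      then show ?thesis using EW(3)[OF W(1,3)] W(4) ne by simp
    next
      case False
      then show ?thesis using cross[OF W(1,2) _ W(3,4)] by simp
    qed
  qed
  have d4: "\<forall>A\<in>d. c A = q"
    using EW(4) unfolding d_def by blast
  show "\<exists>e q. e \<subseteq> {A. A \<subseteq> V \<and> card A = k} \<and> card e = a * b \<and>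
      (\<forall>A\<in>e. \<forall>B\<in>e. A \<noteq> B \<longrightarrow> card (A \<inter> B) \<le> s) \<and> (\<forall>A\<in>e. c A = q)"
    by (intro exI[of _ d] exI[of _ q] conjI d1 d2 d3 d4)
qed

lemma forces_edge_general:
  assumes "r \<ge> 2" "r * (k - 1) + 1 \<le> card V" "s < k" "r * (k - s - 1) + (r - 1) * t < card V"
  shows "forces_edge r V k s t"
  using assms
proof (induction r arbitrary: k s V rule: less_induct)
  case (less r)
  have "finite V" using less.prems(2) by (intro card_ge_0_finite) simp
  show ?case
  proof (cases "prime r")
    case True
    obtain f where "bij_betw f {1..card V} V"
      using ex_bij_betw_nat_finite_1[OF \<open>finite V\<close>] by blast
    then show ?thesis
      using forces_edge_bij forces_edge_prime[OF True] less.prems by blast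
  next
    case False
    then obtain d where "d dvd r" "d \<noteq> 1" "d \<noteq> r"
      using less.prems(1) by (auto simp: prime_nat_iff)
    then obtain d' where "r = d * d'" by blast
    then have "d \<noteq> 0" "d' \<noteq> 0" "d' \<noteq> 1"
      using less.prems(1) \<open>d \<noteq> r\<close> by (intro notI; simp)+
    then have "d > 1" "d' > 1" using \<open>d \<noteq> 1\<close> by linarith+
    \<comment> \<open>Writing the factors as successors keeps truncated subtraction out of the
      arithmetic.\<close>
    define a b where "a = d - 1" and "b = d' - 1"
    have ab: "d = Suc a" "d' = Suc b" "a > 0" "b > 0" using \<open>d > 1\<close> \<open>d' > 1\<close> by (auto simp: a_def b_def)
    have r: "r = Suc a * Suc b" using \<open>r = d * d'\<close> ab by simp
    have lt: "Suc a < r" "Suc b < r" using ab by (auto simp: r)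
    define P where "P u \<longleftrightarrow> r * (k - u - 1) + (r - 1) * t < card V" for u
    \<comment> \<open>Proving the claim for the least admissible overlap suffices by monotonicity,
      and minimality later yields \<open>s0 \<le> t\<close>.\<close>
    define s0 where "s0 = (LEAST u. P u)"
    have "P s" using less.prems by (simp add: P_def)
    then have s0: "P s0" "s0 \<le> s" by (auto simp: s0_def intro: LeastI Least_le)
    define x where "x = k - s0 - 1"
    have k: "k = x + s0 + 1" using s0 less.prems by (simp add: x_def)
    have H1: "r * x + (r - 1) * t < card V" using s0(1) by (simp add: P_def x_def)
    have H2: "r * (x + s0) + 1 \<le> card V" using less.prems by (simp add: k)
    have r1: "r - 1 = a * b + a + b" by (simp add: r)
    have "forces_edge r V k s0 t"
    proof (cases "Suc a * s0 \<le> a * t")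
      case True
      \<comment> \<open>The least size that the counting hypothesis allows for blocks; the case
        assumption supplies the other size hypothesis. With overlap 0 the outer count is exactly
        \<open>r * x + (r - 1) * t\<close>.\<close>
      define m where "m = a * t + Suc a * x + 1"
      have "forces_edge (Suc a) W k s0 t" if "card W = m" for W
        using True ab by (intro less.IH lt) (simp_all add: that k m_def algebra_simps)
      moreover have "forces_edge (Suc b) V m 0 t"
        using H1 ab by (intro less.IH lt) (simp_all add: m_def r1, simp_all add: r algebra_simps)
      ultimately have "forces_edge (Suc a * Suc b) V k s0 t"
        by (intro forces_edge_mult[where m = m and s' = 0]) (auto simp: \<open>finite V\<close> k)
      then show ?thesis by (simp only: r)
    next
      case False
      \<comment> \<open>Here \<open>Suc a * (k - 1) + 1\<close> is the binding lower bound for the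
        blocks. The overlap \<open>s'\<close> absorbs the excess: \<open>m - s' - 1\<close> is what
        \<open>m - 1\<close> was in the first case, so the outer count is unchanged.\<close>
      define m where "m = Suc a * (x + s0) + 1"
      define s' where "s' = Suc a * s0 - a * t"
      have s': "s' + a * t = Suc a * s0" using False by (simp add: s'_def)
      have "s0 > 0" using False by (cases s0) auto
      \<comment> \<open>If \<open>t < s0\<close>, failure of \<open>P (s0 - 1)\<close> would bound
        \<open>card V\<close> by \<open>r * (x + 1) + r * (s0 - 1) = r * (x + s0)\<close>, against
        \<open>H2\<close>.\<close>
      have "s0 \<le> t"
      proof (rule ccontr)
        assume "\<not> s0 \<le> t"
        have "\<not> P (s0 - 1)" using \<open>s0 > 0\<close> not_less_Least[of "s0 - 1" P] by (simp add: s0_def)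
        then have "card V \<le> r * (x + 1) + (r - 1) * t"
          using \<open>s0 > 0\<close> by (simp add: P_def k not_less)
        moreover have "(r - 1) * t \<le> r * (s0 - 1)"
          using \<open>\<not> s0 \<le> t\<close> by (intro mult_mono) auto
        moreover have "r * (x + 1) + r * (s0 - 1) = r * (x + s0)"
          using \<open>s0 > 0\<close> by (simp add: algebra_simps flip: distrib_left)
        ultimately show False using H2 by linarith
      qed
      then have "a * s0 \<le> a * t" by simp
      then have "s' \<le> s0" using s' unfolding mult_Suc by linarith
      have "forces_edge (Suc a) W k s0 t" if "card W = m" for W
        using False ab by (intro less.IH lt) (simp_all add: that k m_def algebra_simps)
      moreover have "forces_edge (Suc b) V m s' t"
      proof (rule less.IH[OF lt(2)])
        have eq: "m - s' - 1 = Suc a * x + a * t"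
          using s' by (simp add: m_def algebra_simps)
        show "Suc b * (m - s' - 1) + (Suc b - 1) * t < card V"
          unfolding eq using H1 by (simp add: r1) (simp add: r algebra_simps)
        show "s' < m" using s' by (simp add: m_def algebra_simps)
        show "Suc b * (m - 1) + 1 \<le> card V" using H2 by (simp add: m_def r algebra_simps)
      qed (use ab in simp)
      ultimately have "forces_edge (Suc a * Suc b) V k s0 t"
        by (intro forces_edge_mult[where m = m and s' = s']) (auto simp: \<open>finite V\<close> k \<open>s' \<le> s0\<close>)
      then show ?thesis by (simp only: r)
    qed
    then show ?thesis using s0(2) by (rule forces_edge_mono)
  qed
qed

section \<open>The bound on the chromatic number\<close>

text \<open>Ensures that the \<open>LEAST\<close> in \<open>chromatic_number\<close> is attained: an
  injective colouring is proper since edges have at least two vertices.\<close>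

lemma proper_coloring_exists:
  assumes "r \<ge> 2"
  shows "\<exists>m c. proper_coloring (KG_vertices n k) (KG_edges r n k s) m c"
proof -
  have "KG_vertices n k \<subseteq> Pow {1..n}" by (auto simp: KG_vertices_def)
  then have "finite (KG_vertices n k)" by (rule finite_subset) simp
  then obtain f where f: "bij_betw f (KG_vertices n k) {1..card (KG_vertices n k)}"
    using ex_bij_betw_finite_nat by (metis bij_betw_inv ex_bij_betw_nat_finite_1)
  have "card (f ` e) \<ge> 2" if "e \<in> KG_edges r n k s" for e
  proof -
    have "e \<subseteq> KG_vertices n k" "card e = r" using that by (auto simp: KG_edges_def)
    then have "card (f ` e) = r"
      using f by (metis bij_betw_def card_image inj_on_subset)
    then show ?thesis using assms by simp
  qed
  then have "proper_coloring (KG_vertices n k) (KG_edges r n k s) (card (KG_vertices n k)) f"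
    using f unfolding proper_coloring_def by (meson bij_betwE)
  then show ?thesis by blast
qed

theorem theorem1:
  fixes k n r s :: nat
  assumes "n \<ge> r * (k - 1) + 1" and "k > s" and "r \<ge> 2"
  shows "int (chromatic_number (KG_vertices n k) (KG_edges r n k s))
           \<ge> \<lceil>(real n - real r * (real k - real s - 1)) / (real r - 1)\<rceil>"
proof (rule ccontr)
  assume neg: "\<not> ?thesis"
  define t where "t = chromatic_number (KG_vertices n k) (KG_edges r n k s)"
  have "\<exists>c. proper_coloring (KG_vertices n k) (KG_edges r n k s) t c"
    unfolding t_def chromatic_number_def by (rule LeastI_ex[OF proper_coloring_exists[OF assms(3)]])
  then obtain c where c: "proper_coloring (KG_vertices n k) (KG_edges r n k s) t c" by blast
  have "real t < (real n - real r * (real k - real s - 1)) / (real r - 1)"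
    using neg by (simp add: t_def not_le less_ceiling_iff)
  then have "real t * (real r - 1) < real n - real r * (real k - real s - 1)"
    using assms(3) by (simp add: less_divide_eq)
  \<comment> \<open>Because \<open>s < k\<close>, natural subtraction agrees here with the real
    subtraction of the statement.\<close>
  moreover have "real (k - s - 1) = real k - real s - 1" "real (r - 1) = real r - 1"
    using assms by (simp_all add: of_nat_diff)
  ultimately have "real (r * (k - s - 1) + (r - 1) * t) < real n"
    unfolding of_nat_add of_nat_mult by (simp add: mult.commute[of "real t"])
  then have forced: "forces_edge r {1..n} k s t"
    using assms by (intro forces_edge_general) (simp_all del: of_nat_add of_nat_mult)
  have col: "c A \<in> {1..t}" if "A \<subseteq> {1..n}" "card A = k" for A
    using c that by (simp add: proper_coloring_def KG_vertices_def)
  obtain e q where e: "e \<subseteq> {A. A \<subseteq> {1..n} \<and> card A = k}" "card e = r"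
      "\<And>A B. A \<in> e \<Longrightarrow> B \<in> e \<Longrightarrow> A \<noteq> B \<Longrightarrow> card (A \<inter> B) \<le> s" "\<And>A. A \<in> e \<Longrightarrow> c A = q"
    using forces_edgeE[of r "{1..n}" k s t c, OF forced col] by blast
  have "finite e" using e(2) assms(3) by (intro card_ge_0_finite) simp
  then have "e \<in> KG_edges r n k s"
    using e by (simp add: KG_edges_def KG_vertices_def)
  then have "2 \<le> card (c ` e)" using c by (simp add: proper_coloring_def)
  moreover have "c ` e \<subseteq> {q}" using e(4) by blast
  then have "card (c ` e) \<le> 1" using card_mono[of "{q}" "c ` e"] by simp
  ultimately show False by simp
qed

end
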